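(* Let $0\le b\le a<\infty$ with $a>0$, and let $\eta(x)=\tfrac12(\mathbb{E}[P_x]+\mathbb{E}[T_x])$, where $P_x$ and $T_x$ are the numbers of trapeziums deposited on the parallelogram $\mathcal{P}_x$ and on the trapezium $\mathcal{T}_x$, respectively, under the uniform depositing algorithm with parameters $a,b$. Then $\lim_{x\to\infty}\eta(x)/x=\lambda(a,b)\in(0,\infty)$, where $$\lambda(a,b)=\frac12\int_0^\infty\bigl(2+e^{-tb}-e^{-ta}\bigr)\exp\left(\int_0^t\bigl(-2+e^{-s(a+b)/2}+e^{-as}\bigr)\frac{ds}{s}\right)dt .$$ Moreover, for all $x>2a(e+1)$, $$\left|\eta(x)-\lambda(a,b)\,x+1-\lambda(a,b)\frac{a+b}{2}\right|\le\begin{cases}\left(\dfrac{2e}{x/a}\right)^{x/a-3/2}\dfrac{e^{3/2}K_1}{\sqrt{\pi}}, & \text{if } a=b,\\[2ex]\left(\dfrac{2e}{x/a}\right)^{x/a-5/2}\dfrac{3e^{5/2}(2K_1+K_2)}{\sqrt{\pi}}, & \text{if } a>b,\end{cases}$$ where $K_1=1+2a\left(\frac{2}{a+b}+\lambda(a,b)\right)+\lambda(a,b)\frac{a+b}{2}>0$ and $K_2=\left(\frac{2}{a+b}+\lambda(a,b)\right)\frac{a-b}{2}\ge0$.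
   Context: Fix reals $0\le b\le a<\infty$ with $a>0$. "Trapezium" means isosceles trapezium (degenerating to a triangle if $b=0$ and a rectangle if $a=b$). Strips. $\mathcal{T}_x$ is the trapezium of height $1$ with lower base of length $x+(a-b)/2$ and upper base of length $x-(a-b)/2$. $\mathcal{P}_x$ is the parallelogram of height $1$ with two horizontal parallel sides of length $x$ and acute angle $\arctan(2/(a-b))$ (and $\pi/2$ if $a=b$), whose left-most point is on the upper line. Both have area $x$. The deposited particle is a copy of $\mathcal{T}_{(a+b)/2}$ (bases $a$ and $b$, height $1$), placed with its longer base on the upper line ("up") or on the lower line ("down") of the strip; its position is given by the distance from the left end of that line to the left endpoint of the longer base. Uniform depositing algorithm (UDA). On $\mathcal{P}_x$ with $x>a$: draw $\tau\sim\mathcal{U}(0,2x-2a)$. If $\tau\in(0,x-a)$, deposit up at position $\tau$; the remaining region consists of two strips $\mathcal{P}_\tau$ and $\mathcal{T}_{x-\tau-(a+b)/2}$. If $\tau\in[x-a,2x-2a)$, deposit down at position $y=\tau+a-x$; the remaining strips are $\mathcal{T}_{t}$ and $\mathcal{P}_{x-t-(a+b)/2}$ with $t=y+(a-b)/2$. On $\mathcal{T}_x$ with $(a+b)/2<x<(3a-b)/2$: draw $\tau\sim\mathcal{U}(0,x-(a+b)/2)$ and deposit down at position $\tau$; the remaining strips are $\mathcal{P}_\tau$ and $\mathcal{P}_{x-\tau-(a+b)/2}$. On $\mathcal{T}_x$ with $x\ge(3a-b)/2$ (and $x>(a+b)/2$): draw $\tau\sim\mathcal{U}(0,2x-2a)$.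 If $\tau\in(0,x-(3a-b)/2)$, deposit up at position $\tau$; the remaining strips are $\mathcal{T}_{\tau+(a-b)/2}$ and $\mathcal{T}_{x-\tau-a}$. If $\tau\in[x-(3a-b)/2,2x-2a)$, deposit down at position $y=\tau-(x-(3a-b)/2)$; the remaining strips are $\mathcal{P}_y$ and $\mathcal{P}_{x-y-(a+b)/2}$. (Strips are identified up to reflection.) Conditionally on the first deposition, the procedure continues on the two remaining strips with independent copies of the UDA, recursively, until no remaining strip can fit $\mathcal{T}_{(a+b)/2}$. $P_x$ (resp. $T_x$) is the total number of particles deposited on $\mathcal{P}_x$ (resp. $\mathcal{T}_x$). Conventions: $P_x=0$ for $x\in[0,a)$, $P_a=1$, $T_x=0$ for $x\in[0,(a+b)/2)$, $T_{(a+b)/2}=1$. Also $\eta(0)=0$. *)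

theory Defs
  imports "HOL-Probability.Probability"
begin

text \<open>
  Throughout, \<open>a\<close> and \<open>b\<close> are the lengths of the longer and shorter base of the particle, which
  has height \<open>1\<close>. A strip of height \<open>1\<close> is represented, up to reflection, by its shape and its
  area \<open>x\<close>: \<open>Parallelogram x\<close> has two horizontal sides of length \<open>x\<close> and slanted sides parallel
  to those of the particle, and \<open>Trapezium x\<close> has lower base \<open>x + (a - b) / 2\<close> and upper base
  \<open>x - (a - b) / 2\<close>. The particle itself is \<open>Trapezium ((a + b) / 2)\<close>.
\<close>

datatype strip = Parallelogram real | Trapezium real

fun area :: "strip \<Rightarrow> real" where
  "area (Parallelogram x) = x"
| "area (Trapezium x) = x"

text \<open>The smallest area of a strip of the given shape that can accommodate the particle.\<close>

fun min_area :: "real \<Rightarrow> real \<Rightarrow> strip \<Rightarrow> real" where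
  "min_area a b (Parallelogram x) = a"
| "min_area a b (Trapezium x) = (a + b) / 2"

text \<open>\<open>Up\<close>: the longer base lies on the upper line of the strip; \<open>Down\<close>: on the lower line.\<close>

datatype orientation = Up | Down

text \<open>The number \<open>\<tau>\<close> that determines the deposition is uniform on the interval from \<open>0\<close> to
  \<open>draw_range a b s\<close>.\<close>

fun draw_range :: "real \<Rightarrow> real \<Rightarrow> strip \<Rightarrow> real" where
  "draw_range a b (Parallelogram x) = 2 * x - 2 * a"
| "draw_range a b (Trapezium x) =
    (if x < (3 * a - b) / 2 then x - (a + b) / 2 else 2 * x - 2 * a)"

text \<open>Orientation and position of the particle deposited for a given value of \<open>\<tau>\<close>; the position
  is the distance from the left end of the line carrying the longer base to the left endpoint of
  the longer base.\<close>

fun placement :: "real \<Rightarrow> real \<Rightarrow> strip \<Rightarrow> real \<Rightarrow> orientation \<times> real" where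
  "placement a b (Parallelogram x) \<tau> =
    (if \<tau> < x - a then (Up, \<tau>) else (Down, \<tau> + a - x))"
| "placement a b (Trapezium x) \<tau> =
    (if x < (3 * a - b) / 2 then (Down, \<tau>)
     else if \<tau> < x - (3 * a - b) / 2 then (Up, \<tau>)
     else (Down, \<tau> - (x - (3 * a - b) / 2)))"

text \<open>The strips to the left and to the right of a particle with the given placement.\<close>

fun remaining :: "real \<Rightarrow> real \<Rightarrow> strip \<Rightarrow> orientation \<times> real \<Rightarrow> strip \<times> strip" where
  "remaining a b (Parallelogram x) (Up, y) =
    (Parallelogram y, Trapezium (x - y - (a + b) / 2))"
| "remaining a b (Parallelogram x) (Down, y) =
    (Trapezium (y + (a - b) / 2), Parallelogram (x - (y + (a - b) / 2) - (a + b) / 2))"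
| "remaining a b (Trapezium x) (Up, y) =
    (Trapezium (y + (a - b) / 2), Trapezium (x - y - a))"
| "remaining a b (Trapezium x) (Down, y) =
    (Parallelogram y, Parallelogram (x - y - (a + b) / 2))"

text \<open>The uniform distribution on the open interval from \<open>0\<close> to \<open>w\<close>, as a measure whose underlying
  space is that interval.\<close>

definition uniform_draw :: "real \<Rightarrow> real measure" where
  "uniform_draw w = restrict_space (uniform_measure lborel {0<..<w}) {0<..<w}"

lemma space_uniform_draw [simp]: "space (uniform_draw w) = {0<..<w}"
  by (simp add: uniform_draw_def space_restrict_space)

declare bind_cong [fundef_cong]

definition valid_params :: "real \<Rightarrow> real \<Rightarrow> bool" where
  "valid_params a b \<longleftrightarrow> 0 \<le> b \<and> b \<le> a \<and> 0 < a"

text \<open>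
  The law of the total number of particles that the uniform depositing algorithm deposits on a
  strip, written in the Giry monad. The product measure expresses that, given the first deposition,
  the two remaining strips are filled independently. The test of the parameters only serves to make the
  recursion terminate.
\<close>

function uda_count :: "real \<Rightarrow> real \<Rightarrow> strip \<Rightarrow> nat measure" where
  "uda_count a b s =
    (if \<not> valid_params a b \<or> area s < min_area a b s then return (count_space UNIV) 0
     else if area s = min_area a b s then return (count_space UNIV) 1
     else uniform_draw (draw_range a b s) \<bind> (\<lambda>\<tau>.
            case remaining a b s (placement a b s \<tau>) of (l, r) \<Rightarrow>
              distr (uda_count a b l \<Otimes>\<^sub>M uda_count a b r) (count_space UNIV) (\<lambda>(m, n). 1 + m + n)))"
  by auto

lemma area_remaining:
  assumes "valid_params a b" "min_area a b s < area s" "\<tau> \<in> {0<..<draw_range a b s}"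
    and "remaining a b s (placement a b s \<tau>) = (l, r)"
  shows "0 \<le> area l" "0 \<le> area r" "area l + area r = area s - (a + b) / 2"
proof -
  have "0 \<le> area l \<and> 0 \<le> area r \<and> area l + area r = area s - (a + b) / 2"
  proof (cases s)
    case (Parallelogram x)
    show ?thesis
    proof (cases "\<tau> < x - a")
      case True
      then have "l = Parallelogram \<tau>" "r = Trapezium (x - \<tau> - (a + b) / 2)"
        using assms(4) Parallelogram by simp_all
      then show ?thesis
        using assms(1-3) Parallelogram True by (simp add: valid_params_def)
    next
      case False
      then have "l = Trapezium (\<tau> + a - x + (a - b) / 2)"
        "r = Parallelogram (x - (\<tau> + a - x + (a - b) / 2) - (a + b) / 2)"
        using assms(4) Parallelogram by simp_all
      then show ?thesis
        using assms(1-3) Parallelogram False by (simp add: valid_params_def) argo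
    qed
  next
    case (Trapezium x)
    consider "x < (3 * a - b) / 2" | "(3 * a - b) / 2 \<le> x" "\<tau> < x - (3 * a - b) / 2"
      | "(3 * a - b) / 2 \<le> x" "x - (3 * a - b) / 2 \<le> \<tau>" by linarith
    then show ?thesis
    proof cases
      case 1
      then have "l = Parallelogram \<tau>" "r = Parallelogram (x - \<tau> - (a + b) / 2)"
        using assms(4) Trapezium by simp_all
      then show ?thesis
        using assms(1-3) Trapezium 1 by (simp add: valid_params_def) argo
    next
      case 2
      then have "l = Trapezium (\<tau> + (a - b) / 2)" "r = Trapezium (x - \<tau> - a)"
        using assms(4) Trapezium by simp_all
      then show ?thesis
        using assms(1-3) Trapezium 2 by (simp add: valid_params_def) argo
    next
      case 3
      then have "l = Parallelogram (\<tau> - (x - (3 * a - b) / 2))"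
        "r = Parallelogram (x - (\<tau> - (x - (3 * a - b) / 2)) - (a + b) / 2)"
        using assms(4) Trapezium by simp_all
      then show ?thesis
        using assms(1-3) Trapezium 3 by (simp add: valid_params_def) argo
    qed
  qed
  then show "0 \<le> area l" "0 \<le> area r" "area l + area r = area s - (a + b) / 2"
    by blast+
qed

lemma nat_floor_area_less:
  fixes c u v :: real
  assumes "0 < c" "c \<le> v" "u \<le> v - c"
  shows "nat \<lfloor>u / c\<rfloor> < nat \<lfloor>v / c\<rfloor>"
proof -
  have "u / c \<le> (v - c) / c" using assms by (intro divide_right_mono) auto
  also have "\<dots> = v / c - 1" using assms by (simp add: diff_divide_distrib)
  finally have "\<lfloor>u / c\<rfloor> \<le> \<lfloor>v / c\<rfloor> - 1" by (metis floor_diff_one floor_mono)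
  moreover have "1 \<le> \<lfloor>v / c\<rfloor>" using assms by simp
  ultimately show ?thesis by linarith
qed

termination
proof (relation "Wellfounded.measure (\<lambda>(a, b, s). nat \<lfloor>area s / ((a + b) / 2)\<rfloor>)", goal_cases)
  case 1
  show ?case by simp
next
  case (2 a b s \<tau> l r)
  then have "valid_params a b" and "min_area a b s < area s"
    and "0 \<le> area l" "0 \<le> area r" "area l + area r = area s - (a + b) / 2"
    using area_remaining[of a b s \<tau> l r] by simp_all
  moreover from this have "(a + b) / 2 \<le> area s"
    by (cases s) (simp_all add: valid_params_def)
  ultimately show ?case
    using nat_floor_area_less[of "(a + b) / 2" "area s" "area l"]
    by (simp add: valid_params_def)
next
  case (3 a b s \<tau> l r)
  then have "valid_params a b" and "min_area a b s < area s"
    and "0 \<le> area l" "0 \<le> area r" "area l + area r = area s - (a + b) / 2"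
    using area_remaining[of a b s \<tau> l r] by simp_all
  moreover from this have "(a + b) / 2 \<le> area s"
    by (cases s) (simp_all add: valid_params_def)
  ultimately show ?case
    using nat_floor_area_less[of "(a + b) / 2" "area s" "area r"]
    by (simp add: valid_params_def)
qed

declare uda_count.simps [simp del]

definition expected_count :: "real \<Rightarrow> real \<Rightarrow> strip \<Rightarrow> real" where
  "expected_count a b s = (\<integral>n. real n \<partial>uda_count a b s)"

definition eta :: "real \<Rightarrow> real \<Rightarrow> real \<Rightarrow> real" where
  "eta a b x = (expected_count a b (Parallelogram x) + expected_count a b (Trapezium x)) / 2"

definition lambda_integrand :: "real \<Rightarrow> real \<Rightarrow> real \<Rightarrow> real" where
  "lambda_integrand a b t =
    (2 + exp (- t * b) - exp (- t * a)) *
    exp (LINT s:{0<..<t}|lborel. (- 2 + exp (- s * (a + b) / 2) + exp (- a * s)) / s)"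

definition lam :: "real \<Rightarrow> real \<Rightarrow> real" where
  "lam a b = (LINT t:{0<..}|lborel. lambda_integrand a b t) / 2"

definition K1 :: "real \<Rightarrow> real \<Rightarrow> real" where
  "K1 a b = 1 + 2 * a * (2 / (a + b) + lam a b) + lam a b * (a + b) / 2"

definition K2 :: "real \<Rightarrow> real \<Rightarrow> real" where
  "K2 a b = (2 / (a + b) + lam a b) * (a - b) / 2"

end

theory Submission
  imports Defs
begin

text \<open>
  Write \<open>c = (a + b) / 2\<close> and \<open>d = (a - b) / 2\<close>. Conditioning on the first deposition turns the algorithm
  into two coupled renewal equations for the mean counts on parallelograms and on trapezia. Their
  average \<open>\<eta>\<close> satisfies a single delay equation, lemma \<open>eta_equation\<close>:
  \<open>(x - a) (\<eta>(x) - 1) = \<integral>\<^sub>0\<^bsup>x - a\<^esup> \<eta> + \<integral>\<^sub>0\<^bsup>x - c\<^esup> \<eta>\<close> for \<open>x \<ge> a\<close>,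
  with \<open>\<eta> = 0\<close> on \<open>[0, c)\<close> and \<open>\<eta> = 1/2\<close> on \<open>[c, a)\<close>. Hence \<open>y = \<eta> + 1\<close> solves the homogeneous
  equation \<open>((x - a) y(x))' = y(x - a) + y(x - c)\<close>, and so does \<open>x + c\<close>.

  The constant \<open>\<lambda>\<close> comes from the adjoint equation \<open>(x - a) \<psi>'(x) = - \<psi>(x + a) - \<psi>(x + c)\<close>. Its decaying
  solution is the Laplace transform \<open>\<psi>(x) = \<integral> t e\<^bsup>-(x - a) t\<^esup> E(t) dt\<close>, where
  \<open>E(t) = exp (\<integral>\<^sub>0\<^sup>t (- 2 + e\<^bsup>- c s\<^esup> + e\<^bsup>- a s\<^esup>) ds / s)\<close> is the exponential in the formula for \<open>\<lambda>\<close>. The bilinear pairing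
  \<open>W(y, x) = (x - a) \<psi>(x) y(x) + \<integral>\<^bsub>x - a\<^esub>\<^sup>x y(u) \<psi>(u + a) du + \<integral>\<^bsub>x - c\<^esub>\<^sup>x y(u) \<psi>(u + c) du\<close>
  does not depend on \<open>x\<close> when \<open>y\<close> is a solution (\<open>pairing_const\<close>). For \<open>x + c\<close> its value is \<open>1\<close>, as the limit
  \<open>x \<rightarrow> \<infinity>\<close> shows (\<open>pairing_affine\<close>); for \<open>\<eta> + 1\<close> the value at \<open>x = a\<close> is computed from the known initial
  segment and is exactly \<open>\<lambda>\<close> (\<open>pairing_initial\<close>, \<open>lam_eq\<close>).

  So \<open>f(x) = \<eta>(x) + 1 - \<lambda> (x + c)\<close> is a solution with vanishing pairing. All weights in the pairing are
  positive, so \<open>f\<close> cannot keep a strict sign and has a zero in every interval \<open>[x - a, x]\<close> with \<open>x > 2 a\<close>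
  (\<open>pairing_zero_imp_root\<close>). Comparing the delay equation at \<open>x\<close> and at a nearby zero shows that \<open>f\<close> is
  bounded, and that a bound \<open>B\<close> on \<open>[u - a, \<infinity>)\<close> improves to \<open>2 a B / (u - a)\<close> on \<open>[u, \<infinity>)\<close>
  (\<open>solution_bound_gain\<close>). Iterating this in steps of \<open>a\<close> gives the factorial decay; the bound
  \<open>(2 e / z)\<^bsup>z - 3/2\<^esup>\<close> with \<open>z = x / a\<close> is compared with the iteration step by step (\<open>decay_step\<close>), so that
  Stirling's formula is not needed.
\<close>

section \<open>Integrals over intervals and half-lines\<close>

lemma integrable_on_bounded_borel:
  fixes h :: "real \<Rightarrow> real"
  assumes "h \<in> borel_measurable borel" "\<And>x. x \<in> {\<alpha>..\<beta>} \<Longrightarrow> \<bar>h x\<bar> \<le> B"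
  shows "h integrable_on {\<alpha>..\<beta>}"
proof -
  have "set_integrable lborel {\<alpha>..\<beta>} h"
    unfolding set_integrable_def
    using assms by (intro integrableI_bounded_set_indicator[where B = B])
      (auto simp: emeasure_lborel_Icc_eq)
  then show ?thesis by (rule set_borel_integral_eq_integral)
qed

lemma has_integral_shift:
  fixes h :: "real \<Rightarrow> real"
  assumes "h integrable_on {\<alpha> + k..\<beta> + k}"
  shows "((\<lambda>\<tau>. h (\<tau> + k)) has_integral integral {\<alpha> + k..\<beta> + k} h) {\<alpha>..\<beta>}"
  using has_integral_affinity'[of h _ "\<alpha> + k" "\<beta> + k" 1 k] integrable_integral[OF assms]
  by simp

lemma has_integral_reflect_shift:
  fixes h :: "real \<Rightarrow> real"
  assumes "h integrable_on {k - \<beta>..k - \<alpha>}"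
  shows "((\<lambda>\<tau>. h (k - \<tau>)) has_integral integral {k - \<beta>..k - \<alpha>} h) {\<alpha>..\<beta>}"
proof -
  have "((\<lambda>\<tau>. h (\<tau> + k)) has_integral integral {k - \<beta>..k - \<alpha>} h) {- \<beta>..- \<alpha>}"
    using has_integral_shift[of h "- \<beta>" k "- \<alpha>"] assms by (simp add: add.commute)
  from has_integral_reflect_real[THEN iffD2, OF this]
  show ?thesis by (simp add: add.commute)
qed


lemma set_integral_times_exp:
  fixes k :: real
  assumes "0 < k"
  shows "set_integrable lborel {0<..} (\<lambda>t. t * exp (- (k * t)))"
    and "(LINT t:{0<..}|lborel. t * exp (- (k * t))) = 1 / k\<^sup>2"
proof -
  define F where "F t = - (t / k + 1 / k\<^sup>2) * exp (- (k * t))" for t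
  have lim: "(F \<longlongrightarrow> 0) at_top"
  proof -
    have z: "filterlim (\<lambda>t. k * t) at_top at_top"
      using assms by (simp add: filterlim_tendsto_pos_mult_at_top[OF tendsto_const] filterlim_ident)
    have 0: "((\<lambda>t. (k * t) ^ 0 / exp (k * t)) \<longlongrightarrow> 0) at_top"
      "((\<lambda>t. (k * t) ^ 1 / exp (k * t)) \<longlongrightarrow> 0) at_top"
      by (rule filterlim_compose[OF tendsto_power_div_exp_0 z])+
    have "((\<lambda>t. - (1 / k\<^sup>2) * ((k * t) ^ 1 / exp (k * t) + (k * t) ^ 0 / exp (k * t))) \<longlongrightarrow>
        - (1 / k\<^sup>2) * (0 + 0)) at_top"
      by (intro tendsto_intros 0)
    then show ?thesis
      using assms by (simp add: F_def[abs_def] exp_minus field_simps power2_eq_square)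
  qed
  have "(F has_real_derivative t * exp (- (k * t))) (at t)" for t
    unfolding F_def using assms
    by (auto intro!: derivative_eq_intros simp: field_simps power2_eq_square)
  then have "(\<integral>\<^sup>+t. ennreal (t * exp (- (k * t))) * indicator {0..} t \<partial>lborel) = ennreal (0 - F 0)"
    using lim by (intro nn_integral_FTC_atLeast) auto
  also have "(\<integral>\<^sup>+t. ennreal (t * exp (- (k * t))) * indicator {0..} t \<partial>lborel) =
      (\<integral>\<^sup>+t. ennreal (indicator {0<..} t *\<^sub>R (t * exp (- (k * t)))) \<partial>lborel)"
    by (intro nn_integral_cong) (auto simp: indicator_def)
  finally have "has_bochner_integral lborel (\<lambda>t. indicator {0<..} t *\<^sub>R (t * exp (- (k * t)))) (1 / k\<^sup>2)"
    by (intro has_bochner_integral_nn_integral) (auto simp: F_def indicator_def)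
  then show "set_integrable lborel {0<..} (\<lambda>t. t * exp (- (k * t)))"
    and "(LINT t:{0<..}|lborel. t * exp (- (k * t))) = 1 / k\<^sup>2"
    by (auto simp: set_integrable_def set_lebesgue_integral_def has_bochner_integral_iff)
qed

lemma indefinite_integral_deriv:
  fixes h :: "real \<Rightarrow> real"
  assumes "\<And>v. h integrable_on {u..v}" "u < x" "isCont h x"
  shows "((\<lambda>v. integral {u..v} h) has_real_derivative h x) (at x)"
proof -
  have "((\<lambda>v. integral {u..v} h) has_vector_derivative h x) (at x within {u..x + 1} - {})"
    using assms by (intro integral_has_vector_derivative_continuous_at)
      (auto intro: continuous_at_imp_continuous_at_within)
  then show ?thesis
    using assms at_within_Icc_at[of u x "x + 1"] by (simp add: has_real_derivative_iff_has_vector_derivative)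
qed

lemma indefinite_integral_continuous:
  fixes h :: "real \<Rightarrow> real"
  assumes "\<And>v. h integrable_on {u..v}"
  shows "continuous_on {u..} (\<lambda>v. integral {u..v} h)"
proof -
  have "continuous (at x within {u..}) (\<lambda>v. integral {u..v} h)" if "u \<le> x" for x
  proof -
    have "continuous (at x within {u..x + 1}) (\<lambda>v. integral {u..v} h)"
      using indefinite_integral_continuous_1[OF assms, of "x + 1"] that
      by (auto simp: continuous_on_eq_continuous_within)
    moreover have "at x within {u..} = at x within {u..x + 1}"
      using that by (intro at_within_nhd[of _ "{..<x + 1}"]) auto
    ultimately show ?thesis by simp
  qed
  then show ?thesis by (auto simp: continuous_on_eq_continuous_within)
qed

section \<open>The law of the count as a measurable kernel\<close>

abbreviation nat_measure :: "nat measure" where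
  "nat_measure \<equiv> count_space UNIV"

text \<open>The law of the count, cut off at strips of area \<open>k c\<close>. Both remaining strips have area at most
  \<open>x - c\<close>, so level \<open>k + 1\<close> is obtained from level \<open>k\<close> by one deposition; measurability in \<open>x\<close> is
  proved by induction on \<open>k\<close>.\<close>

definition truncated_count :: "real \<Rightarrow> real \<Rightarrow> nat \<Rightarrow> strip \<Rightarrow> nat measure" where
  "truncated_count a b k s =
    (if area s < real k * ((a + b) / 2) then uda_count a b s else return nat_measure 0)"

text \<open>The law of the count on \<open>s\<close> given \<open>\<tau>\<close>, when \<open>F\<close> gives the laws for the two remaining strips.\<close>

definition split_law :: "real \<Rightarrow> real \<Rightarrow> (strip \<Rightarrow> nat measure) \<Rightarrow> strip \<Rightarrow> real \<Rightarrow> nat measure" where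
  "split_law a b F s \<tau> =
    (case remaining a b s (placement a b s \<tau>) of (l, r) \<Rightarrow>
       distr (F l \<Otimes>\<^sub>M F r) nat_measure (\<lambda>(m, n). 1 + m + n))"

text \<open>A family of laws on \<open>nat\<close> indexed by strips that depends measurably on the area, for both shapes.\<close>

definition strip_kernel :: "(strip \<Rightarrow> nat measure) \<Rightarrow> bool" where
  "strip_kernel F \<longleftrightarrow>
    (\<lambda>x. F (Parallelogram x)) \<in> borel \<rightarrow>\<^sub>M prob_algebra nat_measure \<and>
    (\<lambda>x. F (Trapezium x)) \<in> borel \<rightarrow>\<^sub>M prob_algebra nat_measure"

lemma uda_count_eq:
  assumes "valid_params a b"
  shows "uda_count a b s =
    (if area s < min_area a b s then return nat_measure 0
     else if area s = min_area a b s then return nat_measure 1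
     else uniform_draw (draw_range a b s) \<bind> split_law a b (uda_count a b) s)"
  using assms by (subst uda_count.simps) (simp add: split_law_def[abs_def])

lemma draw_range_pos:
  assumes "valid_params a b" "min_area a b s < area s"
  shows "0 < draw_range a b s"
  using assms by (cases s) (auto simp: valid_params_def)

lemma min_area_ge:
  assumes "valid_params a b"
  shows "(a + b) / 2 \<le> min_area a b s"
  using assms by (cases s) (auto simp: valid_params_def)

lemma sets_uniform_draw: "sets (uniform_draw w) = sets (restrict_space borel {0<..<w})"
  unfolding uniform_draw_def by (intro sets_restrict_space_cong) simp

lemma nn_integral_uniform_draw:
  assumes "0 < w"
    and f: "f \<in> borel_measurable borel"
  shows "(\<integral>\<^sup>+\<tau>. f \<tau> \<partial>uniform_draw w) =
    (\<integral>\<^sup>+\<tau>. f \<tau> * indicator {0<..<w} \<tau> \<partial>lborel) / ennreal w"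
proof -
  have "(\<integral>\<^sup>+\<tau>. f \<tau> \<partial>uniform_draw w) =
      (\<integral>\<^sup>+\<tau>. f \<tau> * indicator {0<..<w} \<tau> \<partial>uniform_measure lborel {0<..<w})"
    unfolding uniform_draw_def by (subst nn_integral_restrict_space) (auto)
  also have "\<dots> = (\<integral>\<^sup>+\<tau>. f \<tau> * indicator {0<..<w} \<tau> * indicator {0<..<w} \<tau> \<partial>lborel) /
      emeasure lborel {0<..<w}"
    using f by (subst nn_integral_uniform_measure) auto
  also have "(\<lambda>\<tau>. f \<tau> * indicator {0<..<w} \<tau> * indicator {0<..<w} \<tau>) =
      (\<lambda>\<tau>. f \<tau> * indicator {0<..<w} \<tau>)"
    by (auto simp: indicator_def)
  finally show ?thesis using assms by simp
qed

lemma prob_space_uniform_draw: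
  assumes "0 < w"
  shows "prob_space (uniform_draw w)"
proof
  have "emeasure (uniform_draw w) (space (uniform_draw w)) = (\<integral>\<^sup>+\<tau>. 1 \<partial>uniform_draw w)"
    by simp
  also have "\<dots> = 1"
    using assms by (subst nn_integral_uniform_draw) (auto simp: ennreal_divide_self)
  finally show "emeasure (uniform_draw w) (space (uniform_draw w)) = 1" .
qed

lemma split_law_measurable:
  assumes "strip_kernel F"
  shows "(\<lambda>(x, \<tau>). split_law a b F (Parallelogram x) \<tau>) \<in> borel \<Otimes>\<^sub>M borel \<rightarrow>\<^sub>M prob_algebra nat_measure"
    and "(\<lambda>(x, \<tau>). split_law a b F (Trapezium x) \<tau>) \<in> borel \<Otimes>\<^sub>M borel \<rightarrow>\<^sub>M prob_algebra nat_measure"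
proof -
  have P: "(\<lambda>x. F (Parallelogram x)) \<in> borel \<rightarrow>\<^sub>M prob_algebra nat_measure"
    and T: "(\<lambda>x. F (Trapezium x)) \<in> borel \<rightarrow>\<^sub>M prob_algebra nat_measure"
    using assms by (auto simp: strip_kernel_def)
  note [measurable] = measurable_compose[OF _ P] measurable_compose[OF _ T]
  define D where "D = (\<lambda>M N :: nat measure. distr (M \<Otimes>\<^sub>M N) nat_measure (\<lambda>(m, n). 1 + m + n))"
  have [measurable]: "(\<lambda>z. D (f z) (g z)) \<in> M \<rightarrow>\<^sub>M prob_algebra nat_measure"
    if [measurable]: "f \<in> M \<rightarrow>\<^sub>M prob_algebra nat_measure" "g \<in> M \<rightarrow>\<^sub>M prob_algebra nat_measure"
    for f g and M :: "(real \<times> real) measure"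
    unfolding D_def by measurable
  have "(\<lambda>(x, \<tau>). split_law a b F (Parallelogram x) \<tau>) =
      (\<lambda>z. if snd z < fst z - a
        then D (F (Parallelogram (snd z))) (F (Trapezium (fst z - snd z - (a + b) / 2)))
        else D (F (Trapezium (snd z + a - fst z + (a - b) / 2)))
          (F (Parallelogram (fst z - (snd z + a - fst z + (a - b) / 2) - (a + b) / 2))))"
    by (auto simp: split_law_def D_def fun_eq_iff)
  also have "\<dots> \<in> borel \<Otimes>\<^sub>M borel \<rightarrow>\<^sub>M prob_algebra nat_measure"
    by measurable
  finally show "(\<lambda>(x, \<tau>). split_law a b F (Parallelogram x) \<tau>) \<in>
    borel \<Otimes>\<^sub>M borel \<rightarrow>\<^sub>M prob_algebra nat_measure" .
  have "(\<lambda>(x, \<tau>). split_law a b F (Trapezium x) \<tau>) =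
      (\<lambda>z. if fst z < (3 * a - b) / 2 then
          D (F (Parallelogram (snd z))) (F (Parallelogram (fst z - snd z - (a + b) / 2)))
        else if snd z < fst z - (3 * a - b) / 2
        then D (F (Trapezium (snd z + (a - b) / 2))) (F (Trapezium (fst z - snd z - a)))
        else D (F (Parallelogram (snd z - (fst z - (3 * a - b) / 2))))
          (F (Parallelogram (fst z - (snd z - (fst z - (3 * a - b) / 2)) - (a + b) / 2))))"
    by (auto simp: split_law_def D_def fun_eq_iff)
  also have "\<dots> \<in> borel \<Otimes>\<^sub>M borel \<rightarrow>\<^sub>M prob_algebra nat_measure"
    by measurable
  finally show "(\<lambda>(x, \<tau>). split_law a b F (Trapezium x) \<tau>) \<in>
    borel \<Otimes>\<^sub>M borel \<rightarrow>\<^sub>M prob_algebra nat_measure" .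
qed

lemma split_law_measurable_draw:
  assumes "strip_kernel F"
  shows "split_law a b F s \<in> borel \<rightarrow>\<^sub>M prob_algebra nat_measure"
proof (cases s)
  case (Parallelogram x)
  show ?thesis
    using measurable_compose[OF measurable_Pair1'[of x borel borel] split_law_measurable(1)[OF assms, of a b]]
    by (simp add: Parallelogram)
next
  case (Trapezium x)
  show ?thesis
    using measurable_compose[OF measurable_Pair1'[of x borel borel] split_law_measurable(2)[OF assms, of a b]]
    by (simp add: Trapezium)
qed

lemma measurable_uniform_draw:
  assumes "f \<in> borel \<rightarrow>\<^sub>M N"
  shows "f \<in> uniform_draw w \<rightarrow>\<^sub>M N"
  using measurable_restrict_space1[OF assms, of "{0<..<w}"] measurable_cong_sets[OF sets_uniform_draw refl]
  by blast

lemma split_law_truncated: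
  assumes "valid_params a b" "min_area a b s < area s" "\<tau> \<in> {0<..<draw_range a b s}"
    and "area s < real (Suc k) * ((a + b) / 2)"
  shows "split_law a b (uda_count a b) s \<tau> = split_law a b (truncated_count a b k) s \<tau>"
proof -
  obtain l r where lr: "remaining a b s (placement a b s \<tau>) = (l, r)" by fastforce
  note ar = area_remaining[OF assms(1-3) lr]
  have "area l < real k * ((a + b) / 2)" "area r < real k * ((a + b) / 2)"
    using ar assms(4) unfolding of_nat_Suc distrib_right by linarith+
  then show ?thesis by (simp add: split_law_def lr truncated_count_def)
qed

lemma truncated_count_Suc:
  assumes "valid_params a b"
  shows "truncated_count a b (Suc k) s =
    (if area s < min_area a b s \<or> real (Suc k) * ((a + b) / 2) \<le> area s then return nat_measure 0
     else if area s = min_area a b s then return nat_measure 1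
     else uniform_draw (draw_range a b s) \<bind> split_law a b (truncated_count a b k) s)"
proof -
  have "uniform_draw (draw_range a b s) \<bind> split_law a b (uda_count a b) s =
      uniform_draw (draw_range a b s) \<bind> split_law a b (truncated_count a b k) s"
    if "min_area a b s < area s" "area s < real (Suc k) * ((a + b) / 2)"
    using split_law_truncated[OF assms that(1) _ that(2)] by (intro bind_cong) auto
  then show ?thesis
    unfolding truncated_count_def[of a b "Suc k"] uda_count_eq[OF assms, of s] by auto
qed

lemma emeasure_draw_bind:
  assumes "0 < w" "f \<in> borel \<rightarrow>\<^sub>M prob_algebra nat_measure"
  shows "emeasure (uniform_draw w \<bind> f) A =
    (\<integral>\<^sup>+\<tau>. emeasure (f \<tau>) A * indicator {0<..<w} \<tau> \<partial>lborel) / ennreal w"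
proof -
  note f = measurable_prob_algebraD[OF assms(2)]
  have "emeasure (uniform_draw w \<bind> f) A = (\<integral>\<^sup>+\<tau>. emeasure (f \<tau>) A \<partial>uniform_draw w)"
    using assms(1) by (intro emeasure_bind[OF _ measurable_uniform_draw[OF f]]) auto
  also have "\<dots> = (\<integral>\<^sup>+\<tau>. emeasure (f \<tau>) A * indicator {0<..<w} \<tau> \<partial>lborel) / ennreal w"
    using measurable_compose[OF f measurable_emeasure_subprob_algebra[of A]] assms(1)
    by (intro nn_integral_uniform_draw) auto
  finally show ?thesis .
qed

lemma prob_space_draw_bind:
  assumes "0 < w" "f \<in> borel \<rightarrow>\<^sub>M prob_algebra nat_measure"
  shows "prob_space (uniform_draw w \<bind> f)" "sets (uniform_draw w \<bind> f) = UNIV"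
proof -
  have "f \<in> uniform_draw w \<rightarrow>\<^sub>M prob_algebra nat_measure"
    using assms by (intro measurable_uniform_draw)
  moreover have "uniform_draw w \<in> space (prob_algebra (uniform_draw w))"
    using prob_space_uniform_draw[OF assms(1)] by (simp add: space_prob_algebra)
  ultimately show "prob_space (uniform_draw w \<bind> f)" "sets (uniform_draw w \<bind> f) = UNIV"
    using prob_space_bind' sets_bind'[of "uniform_draw w" _ f nat_measure] by auto
qed

text \<open>One deposition preserves measurability. The domain of \<open>\<tau>\<close> varies with \<open>x\<close>, so the bind is
  evaluated on each event as a Lebesgue integral of a jointly measurable function, and Fubini applies.\<close>

lemma deposition_step_measurable:
  fixes S :: "real \<Rightarrow> strip"
  assumes valid: "valid_params a b"
    and F: "(\<lambda>(x, \<tau>). split_law a b F (S x) \<tau>) \<in> borel \<Otimes>\<^sub>M borel \<rightarrow>\<^sub>M prob_algebra nat_measure"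
    and [simp]: "\<And>x. area (S x) = x"
    and [measurable]: "(\<lambda>x. min_area a b (S x)) \<in> borel_measurable borel"
      "(\<lambda>x. draw_range a b (S x)) \<in> borel_measurable borel"
  shows "(\<lambda>x. if x < min_area a b (S x) \<or> m \<le> x then return nat_measure 0
      else if x = min_area a b (S x) then return nat_measure 1
      else uniform_draw (draw_range a b (S x)) \<bind> split_law a b F (S x))
    \<in> borel \<rightarrow>\<^sub>M prob_algebra nat_measure" (is "?L \<in> _")
proof (rule measurable_prob_algebraI[OF _ measurable_subprob_algebra])
  have Fx: "split_law a b F (S x) \<in> borel \<rightarrow>\<^sub>M prob_algebra nat_measure" for x
    using measurable_compose[OF measurable_Pair1'[of x borel borel] F] by simp
  have pos: "0 < draw_range a b (S x)" if "min_area a b (S x) < x" for x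
    using draw_range_pos[OF valid, of "S x"] that by simp
  show prob: "prob_space (?L x)" for x
    using prob_space_draw_bind[OF pos Fx] by (auto intro!: prob_space_return)
  then show "subprob_space (?L x)" for x
    by (rule prob_space_imp_subprob_space)
  show "sets (?L x) = sets nat_measure" for x
    using prob_space_draw_bind[OF pos Fx] by auto
  fix A assume "A \<in> sets nat_measure"
  have [measurable]: "(\<lambda>(x, \<tau>). emeasure (split_law a b F (S x) \<tau>) A) \<in> borel_measurable (borel \<Otimes>\<^sub>M borel)"
    using measurable_compose[OF measurable_prob_algebraD[OF F] measurable_emeasure_subprob_algebra[of A]]
    by (simp add: split_def)
  have eq: "emeasure (?L x) A =
      (if x < min_area a b (S x) \<or> m \<le> x then indicator A 0
       else if x = min_area a b (S x) then indicator A 1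
       else (\<integral>\<^sup>+\<tau>. emeasure (split_law a b F (S x) \<tau>) A *
         indicator {\<tau>. 0 < \<tau> \<and> \<tau> < draw_range a b (S x)} \<tau> \<partial>lborel) /
           ennreal (draw_range a b (S x)))" for x
    using emeasure_draw_bind[OF pos Fx]
    by (auto simp: greaterThanLessThan_def greaterThan_def lessThan_def Int_def)
  show "(\<lambda>x. emeasure (?L x) A) \<in> borel_measurable borel"
    unfolding eq by measurable
qed

lemma strip_kernel_truncated:
  assumes "valid_params a b"
  shows "strip_kernel (truncated_count a b k)"
proof (induction k)
  case 0
  have "truncated_count a b 0 s = return nat_measure 0" for s
  proof (cases "area s < 0")
    case True
    then have "area s < min_area a b s"
      using min_area_ge[OF assms, of s] assms by (auto simp: valid_params_def)
    then show ?thesis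
      by (simp add: truncated_count_def uda_count_eq[OF assms])
  qed (simp add: truncated_count_def)
  then show ?case
    by (auto simp: strip_kernel_def space_prob_algebra prob_space_return)
next
  case (Suc k)
  note F = split_law_measurable[OF Suc, of a b]
  show ?case
    unfolding strip_kernel_def truncated_count_Suc[OF assms] area.simps
    by (intro conjI deposition_step_measurable[OF assms F(1)] deposition_step_measurable[OF assms F(2)]) simp_all
qed

lemma ex_truncation_level:
  assumes "valid_params a b"
  obtains k where "area s < real (Suc k) * ((a + b) / 2)"
proof -
  have "0 < (a + b) / 2" using assms by (auto simp: valid_params_def)
  then obtain n where "area s < real n * ((a + b) / 2)"
    using reals_Archimedean3 by blast
  moreover have "real n * ((a + b) / 2) \<le> real (Suc n) * ((a + b) / 2)"
    using \<open>0 < (a + b) / 2\<close> by (intro mult_right_mono) auto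
  ultimately show thesis using that[of n] by linarith
qed

lemma uda_count_kernel:
  assumes "valid_params a b"
  shows "uda_count a b s \<in> space (prob_algebra nat_measure)"
proof -
  obtain k where "area s < real (Suc k) * ((a + b) / 2)" using ex_truncation_level[OF assms] .
  then have "uda_count a b s = truncated_count a b (Suc k) s" by (simp add: truncated_count_def)
  moreover have "truncated_count a b (Suc k) s \<in> space (prob_algebra nat_measure)"
    using strip_kernel_truncated[OF assms, of "Suc k"]
    by (cases s) (auto simp: strip_kernel_def dest: measurable_space)
  ultimately show ?thesis by simp
qed

text \<open>The mean count as an extended nonnegative integral, which needs no integrability; lemma
  \<open>mean_count_eq_expected_count\<close> identifies it with \<open>expected_count\<close>.\<close>

definition mean_count :: "real \<Rightarrow> real \<Rightarrow> strip \<Rightarrow> ennreal" where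
  "mean_count a b s = (\<integral>\<^sup>+n. of_nat n \<partial>uda_count a b s)"

lemma mean_count_measurable:
  assumes "valid_params a b"
  shows "(\<lambda>x. mean_count a b (Parallelogram x)) \<in> borel_measurable borel"
    and "(\<lambda>x. mean_count a b (Trapezium x)) \<in> borel_measurable borel"
proof -
  have c: "0 < (a + b) / 2" using assms by (auto simp: valid_params_def)
  have eq: "mean_count a b s = (SUP k. \<integral>\<^sup>+n. of_nat n \<partial>truncated_count a b k s)" for s
  proof (rule antisym)
    obtain k where "area s < real (Suc k) * ((a + b) / 2)" using ex_truncation_level[OF assms] .
    then show "mean_count a b s \<le> (SUP k. \<integral>\<^sup>+n. of_nat n \<partial>truncated_count a b k s)"
      by (intro SUP_upper2[of "Suc k"]) (auto simp: truncated_count_def mean_count_def)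
    show "(SUP k. \<integral>\<^sup>+n. of_nat n \<partial>truncated_count a b k s) \<le> mean_count a b s"
      by (intro SUP_least) (auto simp: truncated_count_def mean_count_def nn_integral_return)
  qed
  have "(\<lambda>M. \<integral>\<^sup>+n. of_nat n \<partial>M) \<in> borel_measurable (subprob_algebra nat_measure)"
    by (intro nn_integral_measurable_subprob_algebra) simp
  note m = measurable_compose[OF measurable_prob_algebraD this]
  note k = strip_kernel_truncated[OF assms, unfolded strip_kernel_def]
  show "(\<lambda>x. mean_count a b (Parallelogram x)) \<in> borel_measurable borel"
    "(\<lambda>x. mean_count a b (Trapezium x)) \<in> borel_measurable borel"
    unfolding eq using m[OF k[THEN conjunct1]] m[OF k[THEN conjunct2]]
    by (auto intro!: borel_measurable_SUP)
qed

lemma mean_count_split_law: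
  assumes "valid_params a b" "remaining a b s (placement a b s \<tau>) = (l, r)"
  shows "(\<integral>\<^sup>+n. of_nat n \<partial>split_law a b (uda_count a b) s \<tau>) =
    1 + mean_count a b l + mean_count a b r"
proof -
  define L where "L = uda_count a b l"
  define R where "R = uda_count a b r"
  have L: "prob_space L" "sets L = sets nat_measure" and R: "prob_space R" "sets R = sets nat_measure"
    using uda_count_kernel[OF assms(1), of l] uda_count_kernel[OF assms(1), of r]
    by (auto simp: space_prob_algebra L_def R_def)
  interpret L: prob_space L by (rule L)
  interpret R: prob_space R by (rule R)
  interpret LR: pair_prob_space L R ..
  note [measurable_cong] = L(2) R(2)
  have "(\<integral>\<^sup>+n. of_nat n \<partial>split_law a b (uda_count a b) s \<tau>) =
      (\<integral>\<^sup>+n. of_nat n \<partial>distr (L \<Otimes>\<^sub>M R) nat_measure (\<lambda>(m, n). 1 + m + n))"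
    by (simp add: split_law_def assms(2) L_def R_def)
  also have "\<dots> = (\<integral>\<^sup>+z. of_nat (case z of (m, n) \<Rightarrow> 1 + m + n) \<partial>(L \<Otimes>\<^sub>M R))"
    by (rule nn_integral_distr) auto
  also have "\<dots> = (\<integral>\<^sup>+m. \<integral>\<^sup>+n. 1 + of_nat m + of_nat n \<partial>R \<partial>L)"
    by (subst R.nn_integral_fst[symmetric]) (auto simp: add.assoc)
  also have "\<dots> = (\<integral>\<^sup>+m. 1 + of_nat m + mean_count a b r \<partial>L)"
    by (subst nn_integral_add) (auto simp: R.emeasure_space_1 mean_count_def R_def[symmetric])
  also have "\<dots> = 1 + mean_count a b l + mean_count a b r"
    by (subst nn_integral_add, simp, simp, subst nn_integral_add)
      (auto simp: L.emeasure_space_1 mean_count_def[of a b l] L_def[symmetric])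
  finally show ?thesis .
qed

lemma mean_count_rec:
  assumes "valid_params a b" "min_area a b s < area s"
  shows "mean_count a b s =
    (\<integral>\<^sup>+\<tau>. (case remaining a b s (placement a b s \<tau>) of (l, r) \<Rightarrow>
        1 + mean_count a b l + mean_count a b r) *
      indicator {0<..<draw_range a b s} \<tau> \<partial>lborel) / ennreal (draw_range a b s)"
proof -
  note w = draw_range_pos[OF assms]
  \<comment> \<open>The law on a fixed strip agrees with a truncation, for which measurability in \<open>\<tau>\<close> is available.\<close>
  obtain k where k: "area s < real (Suc k) * ((a + b) / 2)" using ex_truncation_level[OF assms(1)] .
  define \<kappa> where "\<kappa> = split_law a b (truncated_count a b k) s"
  have \<kappa>: "\<kappa> \<in> borel \<rightarrow>\<^sub>M subprob_algebra nat_measure"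
    unfolding \<kappa>_def
    by (intro measurable_prob_algebraD split_law_measurable_draw strip_kernel_truncated assms)
  have "uda_count a b s = truncated_count a b (Suc k) s"
    using k by (simp add: truncated_count_def)
  also have "\<dots> = uniform_draw (draw_range a b s) \<bind> \<kappa>"
    using assms k by (simp add: truncated_count_Suc \<kappa>_def del: of_nat_Suc)
  finally have "mean_count a b s = (\<integral>\<^sup>+\<tau>. \<integral>\<^sup>+n. of_nat n \<partial>\<kappa> \<tau> \<partial>uniform_draw (draw_range a b s))"
    unfolding mean_count_def using \<kappa>
    by (simp add: nn_integral_bind[OF _ measurable_uniform_draw, where B = nat_measure])
  also have "\<dots> = (\<integral>\<^sup>+\<tau>. (\<integral>\<^sup>+n. of_nat n \<partial>\<kappa> \<tau>) * indicator {0<..<draw_range a b s} \<tau> \<partial>lborel) /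
      ennreal (draw_range a b s)"
    by (intro nn_integral_uniform_draw w measurable_compose[OF \<kappa>]
        nn_integral_measurable_subprob_algebra) auto
  also have "(\<integral>\<^sup>+\<tau>. (\<integral>\<^sup>+n. of_nat n \<partial>\<kappa> \<tau>) * indicator {0<..<draw_range a b s} \<tau> \<partial>lborel) =
    (\<integral>\<^sup>+\<tau>. (case remaining a b s (placement a b s \<tau>) of (l, r) \<Rightarrow>
        1 + mean_count a b l + mean_count a b r) *
      indicator {0<..<draw_range a b s} \<tau> \<partial>lborel)"
    using mean_count_split_law[OF assms(1), of s]
    by (intro nn_integral_cong)
      (auto simp: \<kappa>_def indicator_def split_law_truncated[OF assms _ k, symmetric] split: prod.splits)
  finally show ?thesis .
qed

lemma mean_count_base:
  assumes "valid_params a b"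
  shows "area s < min_area a b s \<Longrightarrow> mean_count a b s = 0"
    and "area s = min_area a b s \<Longrightarrow> mean_count a b s = 1"
  using uda_count_eq[OF assms, of s] by (simp_all add: mean_count_def nn_integral_return)

text \<open>The particles have area \<open>c\<close> each, so at most \<open>x / c\<close> of them fit.\<close>

lemma mean_count_le:
  assumes valid: "valid_params a b"
  shows "mean_count a b s \<le> ennreal (area s / ((a + b) / 2))"
proof -
  have c: "0 < (a + b) / 2" using assms by (auto simp: valid_params_def)
  have "mean_count a b s \<le> ennreal (area s / ((a + b) / 2))" if "area s < real k * ((a + b) / 2)" for k
    using that
  proof (induction k arbitrary: s)
    case 0
    then have "area s < min_area a b s" using min_area_ge[OF valid, of s] c by auto
    then show ?case by (simp add: mean_count_base[OF valid])
  next
    case (Suc k)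
    consider "area s < min_area a b s" | "area s = min_area a b s" | "min_area a b s < area s"
      by linarith
    then show ?case
    proof cases
      case 2
      then have "1 \<le> area s / ((a + b) / 2)" using min_area_ge[OF valid, of s] c by simp
      then show ?thesis using mean_count_base(2)[OF valid 2] by (simp flip: ennreal_1)
    next
      case 3
      define w where "w = draw_range a b s"
      have w: "0 < w" using draw_range_pos[OF valid 3] by (simp add: w_def)
      have *: "1 + mean_count a b l + mean_count a b r \<le> ennreal (area s / ((a + b) / 2))"
        if "\<tau> \<in> {0<..<w}" "remaining a b s (placement a b s \<tau>) = (l, r)" for \<tau> l r
      proof -
        note ar = area_remaining[OF valid 3 that[unfolded w_def]]
        have "area l < real k * ((a + b) / 2)" "area r < real k * ((a + b) / 2)"
          using ar Suc.prems unfolding of_nat_Suc distrib_right by linarith+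
        then have "1 + mean_count a b l + mean_count a b r \<le>
            ennreal 1 + ennreal (area l / ((a + b) / 2)) + ennreal (area r / ((a + b) / 2))"
          using Suc.IH by (intro add_mono) auto
        also have "\<dots> = ennreal (1 + area l / ((a + b) / 2) + area r / ((a + b) / 2))"
          using ar(1,2) c by (simp del: ennreal_1)
        also have "1 + area l / ((a + b) / 2) + area r / ((a + b) / 2) = area s / ((a + b) / 2)"
          using c ar(3)[symmetric]
          by (simp only: add_divide_distrib[symmetric] diff_add_cancel eq_divide_eq) (simp add: divide_simps)
        finally show ?thesis .
      qed
      have "mean_count a b s \<le>
          (\<integral>\<^sup>+\<tau>. ennreal (area s / ((a + b) / 2)) * indicator {0<..<w} \<tau> \<partial>lborel) / ennreal w"
        unfolding mean_count_rec[OF valid 3] w_def[symmetric] using *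
        by (intro divide_right_mono_ennreal nn_integral_mono)
          (auto simp: indicator_def split: prod.splits)
      also have "\<dots> = ennreal (area s / ((a + b) / 2))"
        using w by (simp add: nn_integral_cmult_indicator ennreal_mult_divide_eq)
      finally show ?thesis .
    qed (simp add: mean_count_base[OF valid])
  qed
  then show ?thesis using ex_truncation_level[OF valid, of s] by blast
qed

section \<open>The delay equation for the mean count\<close>

lemma mean_count_eq_expected_count:
  assumes "valid_params a b"
  shows "mean_count a b s = ennreal (expected_count a b s)"
    and "0 \<le> expected_count a b s"
proof -
  have "(\<lambda>n. real n) \<in> borel_measurable (uda_count a b s)"
    using uda_count_kernel[OF assms, of s]
    by (subst measurable_cong_sets[of _ nat_measure _ borel]) (auto simp: space_prob_algebra)
  then have e: "expected_count a b s = enn2real (mean_count a b s)"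
    unfolding expected_count_def mean_count_def
    by (subst integral_eq_nn_integral) (auto simp flip: ennreal_of_nat_eq_real_of_nat)
  have "mean_count a b s < top"
    using mean_count_le[OF assms, of s] by (rule order.strict_trans1) simp
  then show "mean_count a b s = ennreal (expected_count a b s)" "0 \<le> expected_count a b s"
    by (simp_all add: e)
qed

lemma expected_count_measurable:
  assumes "valid_params a b"
  shows "(\<lambda>x. expected_count a b (Parallelogram x)) \<in> borel_measurable borel"
    and "(\<lambda>x. expected_count a b (Trapezium x)) \<in> borel_measurable borel"
proof -
  have "expected_count a b s = enn2real (mean_count a b s)" for s
    using mean_count_eq_expected_count[OF assms, of s] by simp
  then show "(\<lambda>x. expected_count a b (Parallelogram x)) \<in> borel_measurable borel"
    "(\<lambda>x. expected_count a b (Trapezium x)) \<in> borel_measurable borel"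
    using mean_count_measurable[OF assms] by simp_all
qed

lemma expected_count_base:
  assumes "valid_params a b"
  shows "area s < min_area a b s \<Longrightarrow> expected_count a b s = 0"
    and "area s = min_area a b s \<Longrightarrow> expected_count a b s = 1"
  using mean_count_base[OF assms, of s] mean_count_eq_expected_count[OF assms, of s] by simp_all

lemma expected_count_le:
  assumes "valid_params a b" "0 \<le> area s"
  shows "expected_count a b s \<le> area s / ((a + b) / 2)"
  using mean_count_le[OF assms(1), of s] mean_count_eq_expected_count[OF assms(1), of s] assms
  by (simp add: valid_params_def)

lemma expected_count_integrable:
  assumes "valid_params a b"
  shows "(\<lambda>x. expected_count a b (Parallelogram x)) integrable_on {u..v}"
    and "(\<lambda>x. expected_count a b (Trapezium x)) integrable_on {u..v}"
proof -
  have c: "0 < (a + b) / 2" using assms by (auto simp: valid_params_def)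
  have "\<bar>expected_count a b s\<bar> \<le> \<bar>v\<bar> / ((a + b) / 2)" if "area s \<le> v" for s
  proof (cases "0 \<le> area s")
    case True
    have "area s / ((a + b) / 2) \<le> \<bar>v\<bar> / ((a + b) / 2)"
      using that c by (intro divide_right_mono) auto
    then show ?thesis
      using expected_count_le[OF assms True] mean_count_eq_expected_count[OF assms, of s] by linarith
  next
    case False
    then have "area s < min_area a b s" using min_area_ge[OF assms, of s] c by linarith
    then show ?thesis using c by (simp add: expected_count_base[OF assms])
  qed
  then show "(\<lambda>x. expected_count a b (Parallelogram x)) integrable_on {u..v}"
    "(\<lambda>x. expected_count a b (Trapezium x)) integrable_on {u..v}"
    by (auto intro!: integrable_on_bounded_borel[where B = "\<bar>v\<bar> / ((a + b) / 2)"]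
        expected_count_measurable assms)
qed

text \<open>The recursion in a form free of measure theory: it suffices to know the (Henstock-Kurzweil)
  integral of the expected counts over the draw.\<close>

lemma expected_count_rec:
  assumes valid: "valid_params a b" and "min_area a b s < area s"
    and I: "((\<lambda>\<tau>. case remaining a b s (placement a b s \<tau>) of (l, r) \<Rightarrow>
        expected_count a b l + expected_count a b r) has_integral I) {0..draw_range a b s}"
  shows "draw_range a b s * (expected_count a b s - 1) = I"
proof -
  define w where "w = draw_range a b s"
  define g where "g \<tau> = (case remaining a b s (placement a b s \<tau>) of (l, r) \<Rightarrow>
        expected_count a b l + expected_count a b r)" for \<tau>
  have w: "0 < w" using draw_range_pos[OF assms(1,2)] by (simp add: w_def)
  have g0: "0 \<le> g \<tau>" for \<tau>
    using mean_count_eq_expected_count(2)[OF valid] by (auto simp: g_def split: prod.splits)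
  have g: "(g has_integral I) {0..w}" using I by (simp add: g_def[abs_def] w_def)
  have I0: "0 \<le> I" using has_integral_nonneg[OF g] g0 by blast
  have "((\<lambda>\<tau>. 1 + g \<tau>) has_integral w + I) {0<..<w}"
    using has_integral_add[OF has_integral_const_real[of 1 0 w] g] w
    by (simp add: has_integral_Icc_iff_Ioo)
  then have *: "(\<integral>\<^sup>+\<tau>. ennreal (1 + g \<tau>) * indicator {0<..<w} \<tau> \<partial>lborel) = ennreal (w + I)"
    using g0 by (intro nn_integral_has_integral_lebesgue') (auto intro: add_nonneg_nonneg)
  have "ennreal (expected_count a b s) =
      (\<integral>\<^sup>+\<tau>. ennreal (1 + g \<tau>) * indicator {0<..<w} \<tau> \<partial>lborel) / ennreal w"
    unfolding mean_count_eq_expected_count(1)[OF valid, symmetric] mean_count_rec[OF assms(1,2)]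
      w_def[symmetric] g_def
    using mean_count_eq_expected_count[OF valid]
    by (intro arg_cong2[where f = "(/)"] nn_integral_cong refl)
      (auto simp: add.assoc split: prod.splits)
  also have "\<dots> = ennreal ((w + I) / w)"
    unfolding * using w I0 by (intro divide_ennreal) auto
  finally have "expected_count a b s = (w + I) / w"
    using mean_count_eq_expected_count(2)[OF valid] w I0 by (simp del: ennreal_plus)
  then show ?thesis using w by (simp add: w_def[symmetric] field_simps)
qed

text \<open>In this part \<open>p\<close> and \<open>t\<close> are the mean counts on the parallelogram and on the trapezium of area \<open>x\<close>.\<close>

context
  fixes a b c d :: real and p t :: "real \<Rightarrow> real"
  assumes valid: "valid_params a b"
  defines "c \<equiv> (a + b) / 2" and "d \<equiv> (a - b) / 2"
    and "p \<equiv> \<lambda>x. expected_count a b (Parallelogram x)"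
    and "t \<equiv> \<lambda>x. expected_count a b (Trapezium x)"
begin

lemma length_relations: "0 < c" "0 \<le> d" "d \<le> c" "a = c + d" "b = c - d"
  using valid by (auto simp: c_def d_def valid_params_def field_simps)

lemma counts_integrable: "p integrable_on {u..v}" "t integrable_on {u..v}"
  using expected_count_integrable[OF valid] by (simp_all add: p_def t_def)

lemma counts_initial: "x < a \<Longrightarrow> p x = 0" "x < c \<Longrightarrow> t x = 0" "t c = 1"
  using expected_count_base[OF valid] by (simp_all add: p_def t_def c_def)

text \<open>The values at the endpoint \<open>v\<close>, where the counts may jump, do not matter.\<close>

lemma integral_counts_initial:
  "v \<le> a \<Longrightarrow> integral {u..v} p = 0" "v \<le> c \<Longrightarrow> integral {u..v} t = 0"
proof -
  show "integral {u..v} p = 0" if "v \<le> a"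
    using that has_integral_spike_finite[of "{v}" "{u..v}" p "\<lambda>_. 0" 0] counts_initial(1)
    by (intro integral_unique) auto
  show "integral {u..v} t = 0" if "v \<le> c"
    using that has_integral_spike_finite[of "{v}" "{u..v}" t "\<lambda>_. 0" 0] counts_initial(2)
    by (intro integral_unique) auto
qed

lemma parallelogram_equation:
  assumes "a < x"
  shows "(x - a) * (p x - 1) = integral {0..x - a} p + integral {d..x - c} t"
proof -
  define s where "s = Parallelogram x"
  define g where "g \<tau> = (case remaining a b s (placement a b s \<tau>) of (l, r) \<Rightarrow>
        expected_count a b l + expected_count a b r)" for \<tau>
  have g1: "g \<tau> = p \<tau> + t ((x - c) - \<tau>)" if "\<tau> < x - a" for \<tau>
    using that by (simp add: g_def s_def p_def t_def c_def algebra_simps)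
  have g2: "g \<tau> = t (\<tau> + (a - x + d)) + p ((2 * x - 2 * a) - \<tau>)" if "x - a \<le> \<tau>" for \<tau>
  proof -
    have "x - (\<tau> + a - x + (a - b) / 2) - (a + b) / 2 = (2 * x - 2 * a) - \<tau>"
      by (simp add: field_simps)
    then show ?thesis
      using that by (simp add: g_def s_def p_def t_def d_def algebra_simps)
  qed
  have "((\<lambda>\<tau>. p \<tau> + t ((x - c) - \<tau>)) has_integral
      (integral {0..x - a} p + integral {(x - c) - (x - a)..(x - c) - 0} t)) {0..x - a}"
    by (intro has_integral_add integrable_integral has_integral_reflect_shift counts_integrable)
  then have 1: "(g has_integral (integral {0..x - a} p + integral {d..x - c} t)) {0..x - a}"
    using g1 length_relations by (intro has_integral_spike_finite[of "{x - a}" _ g]) auto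
  have "((\<lambda>\<tau>. t (\<tau> + (a - x + d)) + p ((2 * x - 2 * a) - \<tau>)) has_integral
      (integral {(x - a) + (a - x + d)..(2 * x - 2 * a) + (a - x + d)} t +
       integral {(2 * x - 2 * a) - (2 * x - 2 * a)..(2 * x - 2 * a) - (x - a)} p)) {x - a..2 * x - 2 * a}"
    by (intro has_integral_add has_integral_shift has_integral_reflect_shift counts_integrable)
  also have "(2 * x - 2 * a) + (a - x + d) = x - c" using length_relations by simp
  also have "(x - a) + (a - x + d) = d" by simp
  also have "(2 * x - 2 * a) - (x - a) = x - a" by simp
  finally have 2: "(g has_integral (integral {d..x - c} t + integral {0..x - a} p)) {x - a..2 * x - 2 * a}"
    using g2 by (intro has_integral_spike_finite[of "{}" _ g]) auto
  have "(g has_integral (integral {0..x - a} p + integral {d..x - c} t) +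
      (integral {d..x - c} t + integral {0..x - a} p)) {0..draw_range a b s}"
    using has_integral_combine[OF _ _ 1 2] assms by (simp add: s_def)
  then have "draw_range a b s * (expected_count a b s - 1) =
      2 * (integral {0..x - a} p + integral {d..x - c} t)"
    using expected_count_rec[OF valid, of s] assms by (simp add: s_def g_def[abs_def])
  then show ?thesis by (simp add: s_def p_def algebra_simps)
qed

text \<open>A trapezium with \<open>x < c + 2 d\<close> leaves parallelograms of total area less than \<open>2 d \<le> a\<close>, which hold no
  further particle; for \<open>x = c\<close> the count is \<open>1\<close> by definition.\<close>

lemma trapezium_small:
  assumes "c \<le> x" "x < c + 2 * d"
  shows "t x = 1"
proof (cases "x = c")
  case False
  define s where "s = Trapezium x"
  define g where "g \<tau> = (case remaining a b s (placement a b s \<tau>) of (l, r) \<Rightarrow>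
        expected_count a b l + expected_count a b r)" for \<tau>
  have x: "x < (3 * a - b) / 2" using assms length_relations by (simp add: field_simps)
  have "g \<tau> = 0" if "\<tau> \<in> {0..x - c}" for \<tau>
  proof -
    have "p \<tau> = 0" "p (x - \<tau> - c) = 0"
      using that assms length_relations by (auto intro!: counts_initial(1))
    then show ?thesis using x by (simp add: g_def s_def p_def c_def)
  qed
  moreover have "draw_range a b s = x - c" using x by (simp add: s_def c_def)
  ultimately have "(g has_integral 0) {0..draw_range a b s}"
    by (intro has_integral_is_0) auto
  then have "draw_range a b s * (expected_count a b s - 1) = 0"
    using expected_count_rec[OF valid, of s] assms False by (simp add: s_def g_def[abs_def] c_def)
  with \<open>draw_range a b s = x - c\<close> show ?thesis
    using False by (simp add: s_def t_def)
qed (simp add: counts_initial)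

lemma trapezium_equation:
  assumes "c + 2 * d \<le> x" "c < x"
  shows "(x - a) * (t x - 1) = integral {d..x - a} t + integral {0..x - c} p"
proof -
  define s where "s = Trapezium x"
  define g where "g \<tau> = (case remaining a b s (placement a b s \<tau>) of (l, r) \<Rightarrow>
        expected_count a b l + expected_count a b r)" for \<tau>
  define m where "m = x - c - 2 * d"
  have m: "x - (3 * a - b) / 2 = m" "m \<ge> 0" using assms length_relations by (simp_all add: m_def field_simps)
  have x: "\<not> x < (3 * a - b) / 2" using m by linarith
  have g1: "g \<tau> = t (\<tau> + d) + t ((x - a) - \<tau>)" if "\<tau> < m" for \<tau>
    using that x m(1) by (simp add: g_def s_def t_def d_def algebra_simps)
  have g2: "g \<tau> = p (\<tau> + (- m)) + p ((m + (x - c)) - \<tau>)" if "m \<le> \<tau>" for \<tau>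
  proof -
    have "x - (\<tau> - m) - (a + b) / 2 = (m + (x - c)) - \<tau>"
      by (simp add: c_def)
    then have "p (x - (\<tau> - m) - (a + b) / 2) = p ((m + (x - c)) - \<tau>)"
      by (rule arg_cong)
    then show ?thesis
      using that x by (simp only: g_def s_def p_def m(1) placement.simps remaining.simps if_False
          prod.case not_less[symmetric] uminus_add_conv_diff diff_conv_add_uminus[symmetric] simp_thms)
  qed
  have "((\<lambda>\<tau>. t (\<tau> + d) + t ((x - a) - \<tau>)) has_integral
      (integral {0 + d..m + d} t + integral {(x - a) - m..(x - a) - 0} t)) {0..m}"
    by (intro has_integral_add has_integral_shift has_integral_reflect_shift counts_integrable)
  also have "0 + d = d" by simp
  also have "m + d = x - a" using length_relations by (simp add: m_def)
  also have "(x - a) - m = d" using length_relations by (simp add: m_def)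
  finally have 1: "(g has_integral (integral {d..x - a} t + integral {d..x - a} t)) {0..m}"
    using g1 by (intro has_integral_spike_finite[of "{m}" _ g]) auto
  have "((\<lambda>\<tau>. p (\<tau> + (- m)) + p ((m + (x - c)) - \<tau>)) has_integral
      (integral {m + (- m)..(m + (x - c)) + (- m)} p +
       integral {(m + (x - c)) - (m + (x - c))..(m + (x - c)) - m} p)) {m..m + (x - c)}"
    by (intro has_integral_add has_integral_shift has_integral_reflect_shift counts_integrable)
  then have 2: "(g has_integral (integral {0..x - c} p + integral {0..x - c} p)) {m..m + (x - c)}"
    using g2 by (intro has_integral_spike_finite[of "{}" _ g]) auto
  have dr: "draw_range a b s = m + (x - c)" "draw_range a b s = 2 * (x - a)"
    using x length_relations by (simp_all add: s_def m_def)
  have "(g has_integral (integral {d..x - a} t + integral {d..x - a} t) +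
      (integral {0..x - c} p + integral {0..x - c} p)) {0..draw_range a b s}"
    unfolding dr(1) using assms m by (intro has_integral_combine[OF _ _ 1 2]) auto
  then have "draw_range a b s * (expected_count a b s - 1) =
      2 * (integral {d..x - a} t + integral {0..x - c} p)"
    using expected_count_rec[OF valid, of s] assms by (simp add: s_def g_def[abs_def] c_def)
  then have "2 * ((x - a) * (t x - 1)) = 2 * (integral {d..x - a} t + integral {0..x - c} p)"
    unfolding dr(2) unfolding s_def t_def mult.assoc .
  then show ?thesis by (simp only: mult_left_cancel[of 2] zero_neq_numeral not_False_eq_True)
qed

lemma eta_eq: "eta a b x = (p x + t x) / 2"
  by (simp add: eta_def p_def t_def)

lemma eta_integrable: "eta a b integrable_on {u..v}"
  unfolding eta_eq[abs_def] by (intro integrable_on_divide integrable_add counts_integrable)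

lemma integral_eta: "integral {u..v} (eta a b) = (integral {u..v} p + integral {u..v} t) / 2"
  unfolding eta_eq[abs_def] by (simp add: integral_add counts_integrable)

lemma integral_trapezium_from_zero: "d \<le> v \<Longrightarrow> integral {d..v} t = integral {0..v} t"
  using Henstock_Kurzweil_Integration.integral_combine[of 0 d v t] length_relations counts_integrable integral_counts_initial(2)[of d 0]
  by simp

text \<open>The sum of \<open>parallelogram_equation\<close> and \<open>trapezium_equation\<close> involves \<open>p\<close> and \<open>t\<close> symmetrically. The
  lower limit \<open>d\<close> of the integrals of \<open>t\<close> may be replaced by \<open>0\<close> because \<open>t\<close> vanishes below \<open>c \<ge> d\<close>. At
  \<open>x = a\<close> both sides vanish, whatever the conventional value there.\<close>

lemma eta_equation:
  assumes "a \<le> x"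
  shows "(x - a) * (eta a b x - 1) = integral {0..x - a} (eta a b) + integral {0..x - c} (eta a b)"
proof (cases "x = a")
  case True
  have "x - c \<le> c" "x - c \<le> a" using True length_relations by auto
  then show ?thesis using True by (simp add: integral_eta integral_counts_initial)
next
  case False
  have P: "(x - a) * (p x - 1) = integral {0..x - a} p + integral {0..x - c} t"
    using parallelogram_equation[of x] integral_trapezium_from_zero[of "x - c"] False assms length_relations by simp
  have T: "(x - a) * (t x - 1) = integral {0..x - a} t + integral {0..x - c} p"
  proof (cases "x < c + 2 * d")
    case True
    then have "x - a \<le> c" "x - c \<le> a" using length_relations by auto
    then show ?thesis using trapezium_small[of x] True assms length_relations by (simp add: integral_counts_initial)
  next
    case False
    then show ?thesis
      using trapezium_equation[of x] integral_trapezium_from_zero[of "x - a"] assms \<open>x \<noteq> a\<close> length_relations by simp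
  qed
  have "(x - a) * (eta a b x - 1) = ((x - a) * (p x - 1) + (x - a) * (t x - 1)) / 2"
    by (simp add: eta_eq field_simps)
  then show ?thesis unfolding P T by (simp add: integral_eta field_simps)
qed

lemma eta_zero: "x < c \<Longrightarrow> eta a b x = 0"
  using counts_initial(1,2)[of x] length_relations(2,4) unfolding eta_eq by simp

lemma eta_half: "c \<le> x \<Longrightarrow> x < a \<Longrightarrow> eta a b x = 1 / 2"
  using trapezium_small[of x] counts_initial(1)[of x] length_relations(2,4) unfolding eta_eq by simp

lemma eta_bounds: "0 \<le> eta a b x" "0 \<le> x \<Longrightarrow> eta a b x \<le> x / c"
  using mean_count_eq_expected_count(2)[OF valid] expected_count_le[OF valid, of "Parallelogram x"]
    expected_count_le[OF valid, of "Trapezium x"]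
  by (auto simp: eta_def c_def)

lemma eta_measurable: "eta a b \<in> borel_measurable borel"
  using expected_count_measurable[OF valid] unfolding eta_def[abs_def] by simp

end

section \<open>The solution of the adjoint equation\<close>

text \<open>The analysis of the delay equation only needs its two delays \<open>c \<le> a\<close>.\<close>

locale delays =
  fixes a c :: real
  assumes c_pos: "0 < c" and c_le: "c \<le> a"
begin

lemma a_pos: "0 < a" using c_pos c_le by simp

text \<open>The logarithmic derivative of \<open>E\<close>; the value at \<open>0\<close> is the limit, which makes it continuous.\<close>

definition rate :: "real \<Rightarrow> real" where
  "rate s = (if s = 0 then - (a + c) else (- 2 + exp (- (c * s)) + exp (- (a * s))) / s)"

text \<open>The kernel \<open>E(t) = exp (\<integral>\<^sub>0\<^sup>t (- 2 + e\<^bsup>- c s\<^esup> + e\<^bsup>- a s\<^esup>) ds / s)\<close>; only arguments \<open>t \<ge> 0\<close> matter.\<close>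

definition E :: "real \<Rightarrow> real" where
  "E t = exp (integral {0..t} rate)"

lemma rate_continuous: "continuous_on UNIV rate"
proof -
  have "isCont rate s" for s
  proof (cases "s = 0")
    case True
    have "((\<lambda>s. - 2 + exp (- (c * s)) + exp (- (a * s))) has_real_derivative - (a + c)) (at 0)"
      by (auto intro!: derivative_eq_intros)
    then have "((\<lambda>s. (- 2 + exp (- (c * s)) + exp (- (a * s))) / s) \<longlongrightarrow> - (a + c)) (at 0)"
      by (simp add: DERIV_def)
    then have "(rate \<longlongrightarrow> - (a + c)) (at 0)"
      by (rule Lim_transform_eventually) (auto simp: rate_def eventually_at intro: exI[of _ 1])
    then show ?thesis using True by (simp add: isCont_def rate_def)
  next
    case False
    then have "\<forall>\<^sub>F x in nhds s. rate x = (- 2 + exp (- (c * x)) + exp (- (a * x))) / x"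
      by (intro eventually_mono[OF t1_space_nhds[of s 0]]) (auto simp: rate_def)
    then show ?thesis
      using False by (subst isCont_cong) (auto intro!: continuous_intros)
  qed
  then show ?thesis by (simp add: continuous_on_eq_continuous_at)
qed

lemma rate_bounds:
  assumes "0 \<le> s"
  shows "- (a + c) \<le> rate s" "rate s \<le> 0"
proof -
  have "1 - c * s \<le> exp (- (c * s))" "1 - a * s \<le> exp (- (a * s))"
    using exp_ge_add_one_self[of "- (c * s)"] exp_ge_add_one_self[of "- (a * s)"] by auto
  then show "- (a + c) \<le> rate s"
    using assms by (auto simp: rate_def field_simps)
  have "exp (- (c * s)) \<le> 1" "exp (- (a * s)) \<le> 1"
    using assms c_pos a_pos by auto
  then have "(- 2 + exp (- (c * s)) + exp (- (a * s))) / s \<le> 0"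
    using assms by (intro divide_nonpos_nonneg) linarith+
  then show "rate s \<le> 0"
    using c_pos a_pos by (simp add: rate_def)
qed

lemma rate_integrable: "rate integrable_on {u..v}"
  using rate_continuous by (intro integrable_continuous_interval) (rule continuous_on_subset, auto)

lemma integral_rate_deriv:
  assumes "0 < t"
  shows "((\<lambda>t. integral {0..t} rate) has_real_derivative rate t) (at t)"
proof -
  have "((\<lambda>t. integral {0..t} rate) has_real_derivative rate t) (at t within {0..t + 1})"
    using assms rate_continuous
    by (intro integral_has_real_derivative) (auto intro: continuous_on_subset)
  then show ?thesis
    using assms at_within_Icc_at[of 0 t "t + 1"] by simp
qed

lemma E_deriv: "0 < t \<Longrightarrow> (E has_real_derivative E t * rate t) (at t)"
  unfolding E_def by (auto intro!: derivative_eq_intros integral_rate_deriv)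

lemma E_pos: "0 < E t" by (simp add: E_def)

lemma E_0 [simp]: "E 0 = 1" by (simp add: E_def)

lemma E_le_1: "0 \<le> t \<Longrightarrow> E t \<le> 1"
  using integral_le[OF rate_integrable, of "\<lambda>_. 0" 0 t] rate_bounds(2)
  by (auto simp: E_def)

lemma E_ge:
  assumes "0 \<le> t"
  shows "exp (- ((a + c) * t)) \<le> E t"
  using integral_le[of "\<lambda>_. - (a + c)" "{0..t}" rate] rate_bounds(1) rate_integrable assms
  by (auto simp: E_def algebra_simps)

lemma E_continuous: "continuous_on {0..} E"
proof -
  have "continuous (at t within {0..}) E" if "0 \<le> t" for t
  proof -
    have "continuous_on {0..t + 1} (\<lambda>t. exp (integral {0..t} rate))"
      by (intro continuous_intros indefinite_integral_continuous_1 rate_integrable)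
    then have "continuous (at t within {0..t + 1}) E"
      using that by (auto simp: E_def[abs_def] continuous_on_eq_continuous_within)
    moreover have "at t within {0..} = at t within {0..t + 1}"
      using that by (intro at_within_nhd[of _ "{..<t + 1}"]) auto
    ultimately show ?thesis by simp
  qed
  then show ?thesis by (auto simp: continuous_on_eq_continuous_within)
qed

lemma E_continuous_pos: "continuous_on {0<..} E"
  by (rule continuous_on_subset[OF E_continuous]) auto

text \<open>The rate is \<open>- 2 / s\<close> up to exponentially small terms, so \<open>E\<close> is of order \<open>t\<^bsup>-2\<^esup>\<close>: the function \<open>q\<close>
  in the proof, which subtracts from \<open>ln (t\<^sup>2 E(t))\<close> a primitive of the majorant \<open>e\<^bsup>- c s\<^esup> + e\<^bsup>- a s\<^esup>\<close> of these
  terms, decreases for \<open>t \<ge> 1\<close>.\<close>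

lemma E_decay:
  assumes "1 \<le> t"
  shows "E t \<le> exp (1 / c + 1 / a) / t\<^sup>2"
proof -
  define q where "q t = integral {0..t} rate + 2 * ln t + exp (- (c * t)) / c + exp (- (a * t)) / a" for t
  have "q t \<le> q 1"
  proof (rule DERIV_nonpos_imp_nonincreasing[OF assms])
    fix s assume s: "1 \<le> s" "s \<le> t"
    have "(q has_real_derivative rate s + 2 / s - exp (- (c * s)) - exp (- (a * s))) (at s)"
      unfolding q_def using s c_pos a_pos
      by (auto intro!: derivative_eq_intros integral_rate_deriv simp: field_simps)
    moreover have "rate s + 2 / s - exp (- (c * s)) - exp (- (a * s)) =
        (exp (- (c * s)) + exp (- (a * s))) * (1 / s - 1)"
      using s by (simp add: rate_def field_simps)
    moreover have "(exp (- (c * s)) + exp (- (a * s))) * (1 / s - 1) \<le> 0"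
      using s by (intro mult_nonneg_nonpos) (auto simp: add_nonneg_nonneg)
    ultimately show "\<exists>y. DERIV q s :> y \<and> y \<le> 0" by auto
  qed
  also have "q 1 \<le> 0 + 0 + 1 / c + 1 / a"
  proof -
    have "integral {0..1} rate \<le> 0" using E_le_1[of 1] by (simp add: E_def)
    moreover have "exp (- c) / c \<le> 1 / c" "exp (- a) / a \<le> 1 / a"
      using c_pos a_pos by (auto intro!: divide_right_mono)
    ultimately show ?thesis by (simp add: q_def)
  qed
  finally have "integral {0..t} rate + 2 * ln t \<le> 1 / c + 1 / a"
    using c_pos a_pos by (simp add: q_def) (smt (verit) divide_nonneg_pos exp_ge_zero)
  then have "exp (integral {0..t} rate) \<le> exp ((1 / c + 1 / a) - 2 * ln t)" by simp
  also have "\<dots> = exp (1 / c + 1 / a) / t\<^sup>2"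
    using assms by (simp add: exp_diff exp_double)
  finally show ?thesis by (simp add: E_def)
qed

lemma E_integrable: "set_integrable lborel {0<..} E"
proof -
  define C where "C = exp (1 / c + 1 / a)"
  have "0 < C" by (simp add: C_def)
  have "set_integrable lborel UNIV (\<lambda>x::real. inverse (1 + x\<^sup>2))"
    using integrable_inverse_1_plus_square by (simp add: einterval_def)
  then have "set_integrable lborel {0<..} (\<lambda>x::real. 2 * (1 + C) * inverse (1 + x\<^sup>2))"
    by (intro set_integrable_mult_right) (auto intro: set_integrable_subset)
  moreover have "set_borel_measurable lborel {0<..} E"
    using borel_measurable_continuous_on_indicator[OF _ E_continuous_pos]
    by (auto simp: set_borel_measurable_def)
  moreover have "E t \<le> 2 * (1 + C) * inverse (1 + t\<^sup>2)" if "0 < t" for t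
  proof (cases "t \<le> 1")
    case True
    then have "t\<^sup>2 \<le> 1" using that by (simp add: power_le_one)
    then have "1 + t\<^sup>2 \<le> 2 * (1 + C)" using \<open>0 < C\<close> by auto
    then have "1 \<le> 2 * (1 + C) * inverse (1 + t\<^sup>2)"
      by (simp add: field_simps add_pos_nonneg)
    then show ?thesis using E_le_1[of t] that by linarith
  next
    case False
    then have t2: "1 \<le> t\<^sup>2" by simp
    have "C * (1 + t\<^sup>2) \<le> C * (2 * t\<^sup>2)" using t2 \<open>0 < C\<close> by (intro mult_left_mono) auto
    also have "\<dots> \<le> 2 * (1 + C) * t\<^sup>2" by (simp add: algebra_simps)
    finally have "C \<le> 2 * (1 + C) * t\<^sup>2 / (1 + t\<^sup>2)"
      using t2 by (subst pos_le_divide_eq) auto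
    then have "C / t\<^sup>2 \<le> 2 * (1 + C) * inverse (1 + t\<^sup>2)"
      using t2 by (subst pos_divide_le_eq) (auto simp: divide_inverse mult_ac)
    then show ?thesis using E_decay[of t] False by (simp add: C_def)
  qed
  ultimately show ?thesis
    by (elim set_integrable_bound) (auto simp: abs_of_pos E_pos intro!: AE_I2 order_trans[OF _ abs_ge_self])
qed

lemma weighted_integrable:
  assumes "continuous_on {0<..} w" "\<And>t. 0 < t \<Longrightarrow> \<bar>w t\<bar> \<le> B"
  shows "set_integrable lborel {0<..} (\<lambda>t. w t * E t)"
proof -
  have "set_integrable lborel {0<..} (\<lambda>t. B * E t)"
    by (intro set_integrable_mult_right E_integrable)
  moreover have "set_borel_measurable lborel {0<..} (\<lambda>t. w t * E t)"
    using borel_measurable_continuous_on_indicator[OF _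
        continuous_on_mult[OF assms(1) E_continuous_pos]]
    by (auto simp: set_borel_measurable_def)
  moreover have "\<bar>w t * E t\<bar> \<le> \<bar>B * E t\<bar>" if "0 < t" for t
    using assms(2)[OF that] E_pos[of t] by (simp add: abs_mult)
  ultimately show ?thesis
    by (elim set_integrable_bound) (auto intro!: AE_I2)
qed

text \<open>The Laplace transform of \<open>E\<close> with argument shifted by \<open>a\<close>, finite for all \<open>x \<ge> a\<close> including \<open>x = a\<close>.\<close>

definition G :: "real \<Rightarrow> real" where
  "G x = (LINT t:{0<..}|lborel. exp (- ((x - a) * t)) * E t)"

text \<open>The adjoint solution \<open>\<psi> = - G'\<close>, finite for \<open>x > a\<close> only: it has a logarithmic singularity at \<open>a\<close>,
  where the default value of the integral is \<open>0\<close>.\<close>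

definition psi :: "real \<Rightarrow> real" where
  "psi x = (LINT t:{0<..}|lborel. (t * exp (- ((x - a) * t))) * E t)"

lemma G_integrable: "a \<le> x \<Longrightarrow> set_integrable lborel {0<..} (\<lambda>t. exp (- ((x - a) * t)) * E t)"
  by (rule weighted_integrable[where B = 1]) (auto intro!: continuous_intros)

lemma psi_integrable:
  assumes "a < x"
  shows "set_integrable lborel {0<..} (\<lambda>t. (t * exp (- ((x - a) * t))) * E t)"
proof (rule weighted_integrable[where B = "1 / (x - a)"])
  fix t :: real assume "0 < t"
  define k where "k = x - a"
  have "t * k \<le> exp (k * t)"
    using exp_ge_add_one_self[of "k * t"] by (simp only: mult.commute[of t])
  then have "t / exp (k * t) \<le> 1 / k"
    using assms by (simp add: k_def divide_simps)
  then show "\<bar>t * exp (- ((x - a) * t))\<bar> \<le> 1 / (x - a)"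
    using \<open>0 < t\<close> by (simp add: exp_minus k_def divide_inverse abs_mult)
qed (auto intro!: continuous_intros)

text \<open>Integration of \<open>(t E(t) e\<^bsup>-(x - a) t\<^esup>)'\<close> over the half-line, where \<open>(t E(t))' = (- 1 + e\<^bsup>- c t\<^esup> + e\<^bsup>- a t\<^esup>) E(t)\<close>.
  The boundary terms vanish even for \<open>x = a\<close>, because \<open>t E(t)\<close> tends to \<open>0\<close> at infinity.\<close>

lemma laplace_by_parts:
  assumes "a \<le> x"
  shows "(LINT t:{0<..}|lborel. ((x - a) * (t * exp (- ((x - a) * t)))) * E t) = G (x + c) + G (x + a) - G x"
proof -
  define k where "k = x - a"
  have k: "0 \<le> k" using assms by (simp add: k_def)
  define f where "f t = exp (- (k * t)) * (- 1 + exp (- (c * t)) + exp (- (a * t)) - k * t) * E t" for t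
  define F where "F t = t * E t * exp (- (k * t))" for t
  \<comment> \<open>For \<open>k = 0\<close> the function \<open>t E(t)\<close> itself is not integrable, but its coefficient vanishes.\<close>
  have kt: "set_integrable lborel {0<..} (\<lambda>t. (k * (t * exp (- (k * t)))) * E t)"
  proof (cases "k = 0")
    case False
    then show ?thesis
      using psi_integrable[of x] k set_integrable_mult_right[of k lborel "{0<..}"]
      by (auto simp: k_def mult.assoc)
  qed (simp add: set_integrable_def)
  note Gi = G_integrable[of x] G_integrable[of "x + c"] G_integrable[of "x + a"]
  have f_eq: "f t = exp (- ((x + c - a) * t)) * E t + exp (- ((x + a - a) * t)) * E t - exp (- ((x - a) * t)) * E t
      - (k * (t * exp (- (k * t)))) * E t" for t
    by (simp add: f_def k_def algebra_simps flip: exp_add)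
  have f_int: "set_integrable lborel {0<..} f"
    unfolding f_eq[abs_def] using assms c_pos a_pos by (intro set_integral_diff set_integral_add Gi kt) auto
  have "(LBINT t=0..\<infinity>. f t) = 0 - 0"
  proof (rule interval_integral_FTC_integrable[where F = F])
    show "set_integrable lborel (einterval 0 \<infinity>) f"
      using f_int by (simp add: einterval_def greaterThan_def)
    fix t :: real assume "0 < ereal t"
    then have t: "0 < t" by simp
    have "(F has_real_derivative f t) (at t)"
      unfolding F_def f_def using t
      by (auto intro!: derivative_eq_intros E_deriv simp: rate_def field_simps)
    then show "(F has_vector_derivative f t) (at t)"
      by (simp add: has_real_derivative_iff_has_vector_derivative)
    have "isCont E t"
      using E_deriv[OF t] by (rule DERIV_isCont)
    then show "isCont f t"
      unfolding f_def by (intro continuous_intros) auto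
  next
    have "(E \<longlongrightarrow> E 0) (at 0 within {0..})"
      using E_continuous by (auto simp: continuous_on simp del: E_0)
    then have "(F \<longlongrightarrow> F 0) (at 0 within {0..})"
      unfolding F_def by (intro tendsto_intros)
    then have "(F \<longlongrightarrow> 0) (at_right 0)"
      by (auto simp: F_def intro: tendsto_within_subset)
    then show "((F \<circ> real_of_ereal) \<longlongrightarrow> 0) (at_right 0)"
      unfolding zero_ereal_def by (simp only: ereal_tendsto_simps)
    define C where "C = exp (1 / c + 1 / a)"
    have "(F \<longlongrightarrow> 0) at_top"
    proof (rule Lim_null_comparison)
      show "((\<lambda>t. C / t) \<longlongrightarrow> 0) at_top"
        by (intro tendsto_divide_0[OF tendsto_const] filterlim_at_top_imp_at_infinity filterlim_ident)
      have "norm (F t) \<le> C / t" if "1 \<le> t" for t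
      proof -
        have "\<bar>F t\<bar> \<le> t * E t"
          using that k E_pos[of t] by (simp add: F_def abs_mult mult_left_le)
        also have "\<dots> \<le> t * (C / t\<^sup>2)"
          using E_decay[OF that] that by (intro mult_left_mono) (auto simp: C_def)
        finally show ?thesis using that by (simp add: power2_eq_square)
      qed
      then show "\<forall>\<^sub>F t in at_top. norm (F t) \<le> C / t"
        using eventually_ge_at_top[of 1] by (rule eventually_mono[rotated])
    qed
    then show "((F \<circ> real_of_ereal) \<longlongrightarrow> 0) (at_left \<infinity>)"
      by (simp add: ereal_tendsto_simps)
  qed simp
  then have "(LINT t:{0<..}|lborel. f t) = 0"
    by (simp add: interval_lebesgue_integral_def einterval_def greaterThan_def)
  then show ?thesis
    unfolding f_eq G_def k_def[symmetric] using assms c_pos a_pos kt Gi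
    by (simp add: set_integral_diff set_integral_add k_def)
qed

text \<open>The adjoint equation in integrated form. At \<open>x = a\<close> the left-hand side is \<open>0\<close>, which yields
  \<open>G a = G (a + c) + G (2 a)\<close>.\<close>

lemma psi_eq:
  assumes "a \<le> x"
  shows "(x - a) * psi x = G (x + c) + G (x + a) - G x"
  using laplace_by_parts[OF assms] by (simp add: psi_def mult.assoc)

text \<open>The two bounds are obtained by replacing \<open>E\<close> by exponentials, from \<open>e\<^bsup>-(a + c) t\<^esup> \<le> E(t) \<le> 1\<close>.\<close>

lemma psi_bounds:
  assumes "a < x"
  shows "1 / (x + c)\<^sup>2 \<le> psi x" "psi x \<le> 1 / (x - a)\<^sup>2" "0 < psi x"
proof -
  have "(LINT t:{0<..}|lborel. t * exp (- ((x + c) * t))) \<le> psi x"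
    unfolding psi_def
  proof (intro set_integral_mono set_integral_times_exp psi_integrable)
    fix t :: real assume "t \<in> {0<..}"
    then have t: "0 < t" by simp
    have "t * exp (- ((x + c) * t)) = t * exp (- ((x - a) * t)) * exp (- ((a + c) * t))"
      by (simp add: algebra_simps flip: exp_add)
    also have "\<dots> \<le> t * exp (- ((x - a) * t)) * E t"
      using t E_ge[of t] by (intro mult_left_mono) auto
    finally show "t * exp (- ((x + c) * t)) \<le> t * exp (- ((x - a) * t)) * E t" .
  qed (use assms c_pos c_le in auto)
  then show 1: "1 / (x + c)\<^sup>2 \<le> psi x"
    using set_integral_times_exp(2)[of "x + c"] assms c_pos c_le by simp
  have "psi x \<le> (LINT t:{0<..}|lborel. t * exp (- ((x - a) * t)))"
    unfolding psi_def
  proof (intro set_integral_mono set_integral_times_exp psi_integrable)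
    fix t :: real assume "t \<in> {0<..}"
    then show "t * exp (- ((x - a) * t)) * E t \<le> t * exp (- ((x - a) * t))"
      using E_le_1[of t] by (simp add: mult_left_le)
  qed (use assms in auto)
  then show "psi x \<le> 1 / (x - a)\<^sup>2"
    using set_integral_times_exp(2)[of "x - a"] assms by simp
  have "0 < 1 / (x + c)\<^sup>2" using assms c_pos c_le by simp
  with 1 show "0 < psi x" by linarith
qed

text \<open>By convexity of the exponential; with the continuity of \<open>psi\<close>, which follows from that of \<open>G\<close> by
  \<open>psi_eq\<close>, this gives the derivative of \<open>G\<close> without differentiating under the integral.\<close>

lemma G_diff:
  assumes "a < x" "x \<le> y"
  shows "(y - x) * psi y \<le> G x - G y" "G x - G y \<le> (y - x) * psi x"
proof -
  have eq: "G x - G y = (LINT t:{0<..}|lborel. (exp (- ((x - a) * t)) - exp (- ((y - a) * t))) * E t)"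
    unfolding G_def left_diff_distrib[of "exp _" "exp _"]
    using assms by (intro set_integral_diff(2)[symmetric] G_integrable) auto
  have int: "set_integrable lborel {0<..} (\<lambda>t. (exp (- ((x - a) * t)) - exp (- ((y - a) * t))) * E t)"
    unfolding left_diff_distrib[of "exp _" "exp _"]
    using assms by (intro set_integral_diff(1) G_integrable) auto
  have *: "(y - x) * t * exp (- ((y - a) * t)) \<le> exp (- ((x - a) * t)) - exp (- ((y - a) * t))"
    "exp (- ((x - a) * t)) - exp (- ((y - a) * t)) \<le> (y - x) * t * exp (- ((x - a) * t))" for t
  proof -
    define h where "h = (y - x) * t"
    have e: "exp (- ((x - a) * t)) = exp (- ((y - a) * t)) * exp h"
      "exp (- ((y - a) * t)) = exp (- ((x - a) * t)) * exp (- h)"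
      by (simp_all add: h_def algebra_simps flip: exp_add)
    have "exp (- ((y - a) * t)) * (1 + h) \<le> exp (- ((y - a) * t)) * exp h"
      by (intro mult_left_mono exp_ge_add_one_self) auto
    then show "(y - x) * t * exp (- ((y - a) * t)) \<le> exp (- ((x - a) * t)) - exp (- ((y - a) * t))"
      by (simp only: e(1)) (simp add: h_def algebra_simps)
    have "exp (- ((x - a) * t)) * (1 + - h) \<le> exp (- ((x - a) * t)) * exp (- h)"
      by (intro mult_left_mono exp_ge_add_one_self) auto
    then show "exp (- ((x - a) * t)) - exp (- ((y - a) * t)) \<le> (y - x) * t * exp (- ((x - a) * t))"
      by (simp only: e(2)) (simp add: h_def algebra_simps)
  qed
  have "(y - x) * psi y = (LINT t:{0<..}|lborel. (y - x) * ((t * exp (- ((y - a) * t))) * E t))"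
    by (simp add: psi_def)
  also have "\<dots> \<le> G x - G y"
    unfolding eq
    using assms mult_right_mono[OF *(1) less_imp_le[OF E_pos]]
    by (intro set_integral_mono set_integrable_mult_right psi_integrable int) (auto simp: mult.assoc)
  finally show "(y - x) * psi y \<le> G x - G y" .
  have "G x - G y \<le> (LINT t:{0<..}|lborel. (y - x) * ((t * exp (- ((x - a) * t))) * E t))"
    unfolding eq
    using assms mult_right_mono[OF *(2) less_imp_le[OF E_pos]]
    by (intro set_integral_mono set_integrable_mult_right psi_integrable int) (auto simp: mult.assoc)
  also have "\<dots> = (y - x) * psi x"
    by (simp add: psi_def)
  finally show "G x - G y \<le> (y - x) * psi x" .
qed

lemma G_continuous: "continuous_on {a..} G"
  unfolding continuous_on_sequentially
proof (intro allI ballI impI, elim conjE)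
  fix X :: "nat \<Rightarrow> real" and x
  assume x: "x \<in> {a..}" and X: "\<forall>n. X n \<in> {a..}" "X \<longlonglongrightarrow> x"
  show "(G \<circ> X) \<longlonglongrightarrow> G x"
    unfolding o_def G_def set_lebesgue_integral_def
  proof (rule integral_dominated_convergence[where w = "\<lambda>t. indicator {0<..} t *\<^sub>R E t"])
    show "integrable lborel (\<lambda>t. indicator {0<..} t *\<^sub>R E t)"
      using E_integrable by (simp add: set_integrable_def)
    show "(\<lambda>t. indicator {0<..} t *\<^sub>R (exp (- ((x - a) * t)) * E t)) \<in> borel_measurable lborel"
      "(\<lambda>t. indicator {0<..} t *\<^sub>R (exp (- ((X n - a) * t)) * E t)) \<in> borel_measurable lborel" for n
      using G_integrable x X(1) by (auto simp: set_integrable_def dest: borel_measurable_integrable)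
    show "AE t in lborel. (\<lambda>n. indicator {0<..} t *\<^sub>R (exp (- ((X n - a) * t)) * E t))
        \<longlonglongrightarrow> indicator {0<..} t *\<^sub>R (exp (- ((x - a) * t)) * E t)"
      by (intro AE_I2 tendsto_intros X(2))
    show "AE t in lborel. norm (indicator {0<..} t *\<^sub>R (exp (- ((X n - a) * t)) * E t))
        \<le> indicator {0<..} t *\<^sub>R E t" for n
      using X(1) less_imp_le[OF E_pos]
      by (intro AE_I2) (auto simp: indicator_def abs_mult mult_left_le_one_le)
  qed
qed

lemma psi_continuous: "continuous_on {a<..} psi"
proof -
  have "continuous_on {a<..} (\<lambda>x. (G (x + c) + G (x + a) - G x) / (x - a))"
    using c_pos a_pos
    by (intro continuous_intros continuous_on_compose2[OF G_continuous]) auto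
  moreover have "(G (x + c) + G (x + a) - G x) / (x - a) = psi x" if "a < x" for x
    using psi_eq[of x] that by (simp add: field_simps)
  ultimately show ?thesis
    by (subst continuous_on_cong[OF refl, of _ _ "\<lambda>x. (G (x + c) + G (x + a) - G x) / (x - a)"]) auto
qed

lemma G_deriv:
  assumes "a < x"
  shows "(G has_real_derivative - psi x) (at x)"
proof -
  have lim: "(psi \<longlongrightarrow> psi x) (at x)"
    using psi_continuous assms by (simp add: continuous_on_eq_continuous_at isCont_def)
  have "((\<lambda>y. (G y - G x) / (y - x)) \<longlongrightarrow> - psi x) (at x)"
  proof (rule real_tendsto_sandwich)
    have ev: "\<forall>\<^sub>F y in at x. a < y \<and> y \<noteq> x"
      using assms eventually_at_topological[of "\<lambda>y. a < y \<and> y \<noteq> x" x UNIV]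
      by (auto intro: exI[of _ "{a<..}"])
    have *: "- max (psi x) (psi y) \<le> (G y - G x) / (y - x) \<and> (G y - G x) / (y - x) \<le> - min (psi x) (psi y)"
      if "a < y" "y \<noteq> x" for y
    proof (cases "x < y")
      case True
      then have "- psi x \<le> (G y - G x) / (y - x)" "(G y - G x) / (y - x) \<le> - psi y"
        using G_diff[of x y] assms by (auto simp: divide_simps algebra_simps)
      then show ?thesis by linarith
    next
      case False
      then have "y < x" using that by simp
      then have "- psi y \<le> (G y - G x) / (y - x)" "(G y - G x) / (y - x) \<le> - psi x"
        using G_diff[of y x] that by (auto simp: divide_simps algebra_simps)
      then show ?thesis by linarith
    qed
    show "\<forall>\<^sub>F y in at x. - max (psi x) (psi y) \<le> (G y - G x) / (y - x)"
      "\<forall>\<^sub>F y in at x. (G y - G x) / (y - x) \<le> - min (psi x) (psi y)"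
      using * by (auto intro: eventually_mono[OF ev])
    show "((\<lambda>y. - max (psi x) (psi y)) \<longlongrightarrow> - psi x) (at x)"
      using tendsto_minus[OF tendsto_max[OF tendsto_const lim, of "psi x"]] by simp
    show "((\<lambda>y. - min (psi x) (psi y)) \<longlongrightarrow> - psi x) (at x)"
      using tendsto_minus[OF tendsto_min[OF tendsto_const lim, of "psi x"]] by simp
  qed
  then show ?thesis by (simp add: has_field_derivative_iff)
qed

lemma psi_has_integral:
  assumes "a \<le> u" "u \<le> v"
  shows "(psi has_integral (G u - G v)) {u..v}"
proof -
  have "(psi has_integral (- G v - (- G u))) {u..v}"
  proof (rule fundamental_theorem_of_calculus_interior[OF assms(2)])
    show "continuous_on {u..v} (\<lambda>x. - G x)"
      using assms by (intro continuous_intros continuous_on_subset[OF G_continuous]) auto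
    show "((\<lambda>x. - G x) has_vector_derivative psi x) (at x)" if "x \<in> {u<..<v}" for x
      using DERIV_minus[OF G_deriv[of x]] that assms
      by (auto simp: has_real_derivative_iff_has_vector_derivative)
  qed
  then show ?thesis by simp
qed

section \<open>Solutions of the delay equation and the invariant pairing\<close>

text \<open>Solutions of \<open>((x - a) y(x))' = y(x - a) + y(x - c)\<close> for \<open>x \<ge> a\<close> in integrated form, with the constant of
  integration \<open>K\<close>. On the initial segment \<open>(0, a)\<close> a jump is allowed only at \<open>c\<close>; for \<open>x > a\<close> continuity follows
  from the equation, and the value at \<open>a\<close> is unconstrained.\<close>

definition solution :: "(real \<Rightarrow> real) \<Rightarrow> real \<Rightarrow> bool" where
  "solution y K \<longleftrightarrow> y \<in> borel_measurable borel \<and> (\<forall>v. \<exists>B. \<forall>u\<in>{0..v}. \<bar>y u\<bar> \<le> B) \<and>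
    (\<forall>u. 0 < u \<and> u < a \<and> u \<noteq> c \<longrightarrow> isCont y u) \<and>
    (\<forall>x\<ge>a. (x - a) * y x = K + integral {0..x - a} y + integral {0..x - c} y)"

text \<open>The bilinear pairing of \<open>y\<close> with the adjoint solution.\<close>

definition pairing :: "(real \<Rightarrow> real) \<Rightarrow> real \<Rightarrow> real" where
  "pairing y x = (x - a) * psi x * y x +
    integral {x - a..x} (\<lambda>u. y u * psi (u + a)) + integral {x - c..x} (\<lambda>u. y u * psi (u + c))"

lemma psi_nonneg: "0 \<le> psi x"
  unfolding psi_def set_lebesgue_integral_def
  by (intro Bochner_Integration.integral_nonneg) (auto simp: indicator_def less_imp_le[OF E_pos])

lemma solution_bounded:
  assumes "solution y K"
  obtains B where "0 \<le> B" "\<And>u. u \<in> {0..v} \<Longrightarrow> \<bar>y u\<bar> \<le> B"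
proof -
  obtain B where "\<forall>u\<in>{0..v}. \<bar>y u\<bar> \<le> B" using assms unfolding solution_def by blast
  then show thesis by (intro that[of "max 0 B"]) force+
qed

lemma solution_integrable:
  assumes "solution y K" "0 \<le> u"
  shows "y integrable_on {u..v}"
proof -
  obtain B where "\<And>u. u \<in> {0..v} \<Longrightarrow> \<bar>y u\<bar> \<le> B" using solution_bounded[OF assms(1)] by blast
  then show ?thesis
    using assms by (intro integrable_on_bounded_borel[where B = B]) (auto simp: solution_def)
qed

lemma solution_numerator_continuous:
  assumes "solution y K"
  shows "continuous_on {a..} (\<lambda>x. (x - a) * y x)"
proof -
  have "continuous_on {a..} (\<lambda>x. K + integral {0..x - a} y + integral {0..x - c} y)"
    using c_le
    by (intro continuous_intros
        continuous_on_compose2[OF indefinite_integral_continuous[OF solution_integrable[OF assms]]]) auto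
  then show ?thesis
    using assms by (subst continuous_on_cong[OF refl,
          of _ _ "\<lambda>x. K + integral {0..x - a} y + integral {0..x - c} y"]) (auto simp: solution_def)
qed

lemma solution_continuous:
  assumes "solution y K"
  shows "continuous_on {a<..} y"
proof -
  have "continuous_on {a<..} (\<lambda>x. ((x - a) * y x) / (x - a))"
    by (intro continuous_intros continuous_on_subset[OF solution_numerator_continuous[OF assms]]) auto
  then show ?thesis
    by (subst continuous_on_cong[OF refl, of _ _ "\<lambda>x. ((x - a) * y x) / (x - a)"]) auto
qed

lemma solution_isCont:
  assumes "solution y K" "0 < u" "u \<noteq> a" "u \<noteq> c"
  shows "isCont y u"
proof (cases "u < a")
  case True
  then show ?thesis using assms by (auto simp: solution_def)
next
  case False
  then show ?thesis
    using solution_continuous[OF assms(1)] assms by (auto simp: continuous_on_eq_continuous_at)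
qed

text \<open>Although \<open>psi\<close> is unbounded near \<open>a\<close>, it is integrable there, with primitive \<open>- G\<close>.\<close>

lemma product_integrable:
  assumes "solution y K" "0 \<le> u" "a \<le> u + k"
  shows "(\<lambda>u. y u * psi (u + k)) integrable_on {u..v}"
proof (cases "u \<le> v")
  case True
  have "psi integrable_on {u + k..v + k}"
    using psi_has_integral[of "u + k" "v + k"] assms True by (auto simp: has_integral_integrable)
  then have "(\<lambda>u. psi (u + k)) absolutely_integrable_on {u..v}"
    using has_integral_shift[of psi u k v] psi_nonneg
    by (intro nonnegative_absolutely_integrable_1) auto
  moreover obtain B where "\<And>u. u \<in> {0..v} \<Longrightarrow> \<bar>y u\<bar> \<le> B" using solution_bounded[OF assms(1)] by blast
  then have "bounded (y ` {u..v})"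
    using assms(2) by (auto simp: bounded_iff intro!: exI[of _ B])
  moreover have "y \<in> borel_measurable (lebesgue_on {u..v})"
    using assms(1) by (auto simp: solution_def intro!: measurable_restrict_space1 measurable_completion)
  ultimately have "(\<lambda>u. y u * psi (u + k)) absolutely_integrable_on {u..v}"
    by (intro absolutely_integrable_bounded_measurable_product_real) auto
  then show ?thesis by (rule set_lebesgue_integral_eq_integral)
qed auto

lemma pairing_indefinite:
  assumes "solution y K" "a \<le> x"
  shows "pairing y x = (x - a) * psi x * y x +
    (integral {0..x} (\<lambda>u. y u * psi (u + a)) - integral {0..x - a} (\<lambda>u. y u * psi (u + a))) +
    (integral {a - c..x} (\<lambda>u. y u * psi (u + c)) - integral {a - c..x - c} (\<lambda>u. y u * psi (u + c)))"
  using assms c_pos c_le product_integrable[OF assms(1), of 0 a x]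
    product_integrable[OF assms(1), of "a - c" c x]
    Henstock_Kurzweil_Integration.integral_combine[of 0 "x - a" x "\<lambda>u. y u * psi (u + a)"]
    Henstock_Kurzweil_Integration.integral_combine[of "a - c" "x - c" x "\<lambda>u. y u * psi (u + c)"]
  by (simp add: pairing_def)

lemma psi_isCont: "a < x \<Longrightarrow> isCont psi x"
  using psi_continuous by (simp add: continuous_on_eq_continuous_at)

lemma product_deriv:
  assumes "solution y K" "0 \<le> u" "a \<le> u + k" "u < v" "v \<noteq> a" "v \<noteq> c"
  shows "((\<lambda>v. integral {u..v} (\<lambda>u. y u * psi (u + k))) has_real_derivative y v * psi (v + k)) (at v)"
  using assms solution_isCont[OF assms(1), of v] psi_isCont[of "v + k"]
  by (intro indefinite_integral_deriv product_integrable[OF assms(1)])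
    (auto intro!: continuous_intros isCont_o2[where g = psi and f = "\<lambda>u. u + k"])

lemma pairing_continuous:
  assumes "solution y K"
  shows "continuous_on {a..v} (pairing y)"
proof -
  have J: "continuous_on {a..v} (\<lambda>x.
    (integral {0..x} (\<lambda>u. y u * psi (u + a)) - integral {0..x - a} (\<lambda>u. y u * psi (u + a))) +
    (integral {a - c..x} (\<lambda>u. y u * psi (u + c)) - integral {a - c..x - c} (\<lambda>u. y u * psi (u + c))))"
    using c_le c_pos
    by (intro continuous_intros
        continuous_on_compose2[OF indefinite_integral_continuous[OF product_integrable[OF assms]]]) auto
  obtain B where B: "\<And>u. u \<in> {0..v} \<Longrightarrow> \<bar>y u\<bar> \<le> B" using solution_bounded[OF assms] by blast
  have T: "continuous (at x within {a..v}) (\<lambda>x. (x - a) * psi x * y x)" if x: "x \<in> {a..v}" for x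
  proof (cases "x = a")
    case False
    then have "isCont (\<lambda>x. (x - a) * psi x * y x) x"
      using x psi_isCont[of x] solution_continuous[OF assms]
      by (intro continuous_intros) (auto simp: continuous_on_eq_continuous_at)
    then show ?thesis by (rule continuous_at_imp_continuous_at_within)
  next
    case True
    have "continuous_on {a..v} (\<lambda>x. G (x + c) + G (x + a) - G x)"
      using c_pos a_pos by (intro continuous_intros continuous_on_compose2[OF G_continuous]) auto
    then have "continuous_on {a..v} (\<lambda>x. (x - a) * psi x)"
      by (subst continuous_on_cong[OF refl psi_eq]) auto
    then have "((\<lambda>x. (x - a) * psi x) \<longlongrightarrow> (a - a) * psi a) (at a within {a..v})"
      using x True by (simp only: continuous_on)
    then have "((\<lambda>x. (x - a) * psi x * B) \<longlongrightarrow> 0) (at a within {a..v})"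
      by (intro tendsto_mult_left_zero) simp
    moreover have "\<forall>\<^sub>F x in at a within {a..v}. norm ((x - a) * psi x * y x) \<le> (x - a) * psi x * B"
      using B psi_nonneg a_pos
      by (auto simp: eventually_at abs_mult intro!: exI[of _ 1] mult_left_mono)
    ultimately have "((\<lambda>x. (x - a) * psi x * y x) \<longlongrightarrow> 0) (at a within {a..v})"
      by (rule Lim_null_comparison[rotated])
    then show ?thesis using True by (simp add: continuous_within)
  qed
  then have "continuous_on {a..v} (\<lambda>x. (x - a) * psi x * y x)"
    by (simp add: continuous_on_eq_continuous_within)
  from continuous_on_add[OF this J] show ?thesis
    by (subst continuous_on_cong[OF refl pairing_indefinite[OF assms]]) (auto simp: add.assoc)
qed

lemma pairing_deriv:
  assumes y: "solution y K" and x: "a < x" "x \<noteq> a + c" "x \<noteq> 2 * a" "x \<noteq> 2 * c"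
  shows "(pairing y has_real_derivative 0) (at x)"
proof -
  define N where "N x = K + integral {0..x - a} y + integral {0..x - c} y" for x
  define J1 where "J1 v = integral {0..v} (\<lambda>u. y u * psi (u + a))" for v
  define J2 where "J2 v = integral {a - c..v} (\<lambda>u. y u * psi (u + c))" for v
  have N_eq: "(x - a) * y x = N x" if "a \<le> x" for x
    using y that by (simp add: solution_def N_def)
  have I: "((\<lambda>v. integral {0..v} y) has_real_derivative y v) (at v)" if "0 < v" "v \<noteq> a" "v \<noteq> c" for v
    using that y by (intro indefinite_integral_deriv solution_integrable solution_isCont) auto
  have N: "(N has_real_derivative y (x - a) + y (x - c)) (at x)"
    unfolding N_def
    using x c_le c_pos
    by (auto intro!: derivative_eq_intros DERIV_chain2[OF I])
  have J1: "(J1 has_real_derivative y v * psi (v + a)) (at v)" if "0 < v" "v \<noteq> a" "v \<noteq> c" for v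
    unfolding J1_def using that by (intro product_deriv[OF y]) auto
  have J2: "(J2 has_real_derivative y v * psi (v + c)) (at v)" if "a - c < v" "v \<noteq> a" "v \<noteq> c" for v
    unfolding J2_def using that c_le by (intro product_deriv[OF y]) auto
  define g where "g x = (G (x + c) + G (x + a) - G x) * (N x / (x - a)) + (J1 x - J1 (x - a)) + (J2 x - J2 (x - c))" for x
  have xc: "x \<noteq> c" "x \<noteq> a" using x c_le by auto
  have dA: "((\<lambda>x. G (x + c) + G (x + a) - G x) has_real_derivative - psi (x + c) - psi (x + a) + psi x) (at x)"
    using x c_pos a_pos by (auto intro!: derivative_eq_intros DERIV_chain2[OF G_deriv])
  have dN: "((\<lambda>x. N x / (x - a)) has_real_derivative (y (x - a) + y (x - c) - y x) / (x - a)) (at x)"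
  proof -
    have "((\<lambda>x. N x / (x - a)) has_real_derivative
        ((y (x - a) + y (x - c)) * (x - a) - N x * 1) / ((x - a) * (x - a))) (at x)"
      using x by (intro DERIV_divide N) (auto intro!: derivative_eq_intros)
    also have "(y (x - a) + y (x - c)) * (x - a) - N x * 1 = (y (x - a) + y (x - c) - y x) * (x - a)"
      using N_eq[of x] x by (simp add: algebra_simps)
    finally show ?thesis using x by simp
  qed
  have dJ: "((\<lambda>x. (J1 x - J1 (x - a)) + (J2 x - J2 (x - c))) has_real_derivative
      (y x * psi (x + a) - y (x - a) * psi (x - a + a)) + (y x * psi (x + c) - y (x - c) * psi (x - c + c))) (at x)"
    using x xc c_pos c_le by (auto intro!: derivative_eq_intros DERIV_chain2[OF J1] DERIV_chain2[OF J2])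
  have "(g has_real_derivative
      ((- psi (x + c) - psi (x + a) + psi x) * (N x / (x - a)) +
        (y (x - a) + y (x - c) - y x) / (x - a) * (G (x + c) + G (x + a) - G x)) +
      ((y x * psi (x + a) - y (x - a) * psi (x - a + a)) + (y x * psi (x + c) - y (x - c) * psi (x - c + c)))) (at x)"
    using DERIV_add[OF DERIV_mult[OF dA dN] dJ] by (simp only: g_def[abs_def] add.assoc)
  also have "((- psi (x + c) - psi (x + a) + psi x) * (N x / (x - a)) +
        (y (x - a) + y (x - c) - y x) / (x - a) * (G (x + c) + G (x + a) - G x)) +
      ((y x * psi (x + a) - y (x - a) * psi (x - a + a)) + (y x * psi (x + c) - y (x - c) * psi (x - c + c))) = 0"
  proof -
    have 1: "N x / (x - a) = y x" using N_eq[of x] x by (simp add: field_simps)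
    have 2: "(y (x - a) + y (x - c) - y x) / (x - a) * (G (x + c) + G (x + a) - G x) =
        (y (x - a) + y (x - c) - y x) * psi x"
      unfolding psi_eq[OF less_imp_le[OF x(1)], symmetric] using x by simp
    show ?thesis unfolding 1 2 by (simp add: algebra_simps)
  qed
  finally show ?thesis
  proof (rule has_field_derivative_transform_within_open[of g 0 x "{a<..}"])
    fix z assume "z \<in> {a<..}"
    then show "g z = pairing y z"
      using pairing_indefinite[OF y, of z] psi_eq[of z] N_eq[of z, symmetric]
      by (simp add: g_def J1_def J2_def)
  qed (use x in auto)
qed

text \<open>The derivative vanishes except possibly at \<open>a\<close> and where one of \<open>x - a\<close>, \<open>x - c\<close> is one of the points \<open>a\<close>, \<open>c\<close> at
  which \<open>y\<close> may jump.\<close>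

lemma pairing_const:
  assumes "solution y K" "a \<le> x"
  shows "pairing y x = pairing y a"
proof (rule has_derivative_zero_unique_strong_interval[where f = "pairing y" and k = "{a, a + c, 2 * a, 2 * c}" and a = a and b = x])
  show "continuous_on {a..x} (pairing y)" by (rule pairing_continuous[OF assms(1)])
  show "(pairing y has_derivative (\<lambda>h. 0)) (at z within {a..x})"
    if "z \<in> {a..x} - {a, a + c, 2 * a, 2 * c}" for z
  proof -
    have "(pairing y has_real_derivative 0) (at z)"
      using that by (intro pairing_deriv[OF assms(1)]) auto
    then show ?thesis
      by (auto simp: has_field_derivative_def lambda_zero[abs_def] intro: has_derivative_at_withinI)
  qed
qed (use assms in auto)

lemma solution_diff:
  assumes "solution y K" "solution z L"
  shows "solution (\<lambda>x. y x - r * z x) (K - r * L)"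
  unfolding solution_def
proof (intro conjI allI impI)
  show "(\<lambda>x. y x - r * z x) \<in> borel_measurable borel"
    using assms by (auto simp: solution_def)
  fix v
  obtain B where "\<And>u. u \<in> {0..v} \<Longrightarrow> \<bar>y u\<bar> \<le> B" using solution_bounded[OF assms(1)] by blast
  moreover obtain C where "\<And>u. u \<in> {0..v} \<Longrightarrow> \<bar>z u\<bar> \<le> C" using solution_bounded[OF assms(2)] by blast
  ultimately have "\<bar>y u - r * z u\<bar> \<le> B + \<bar>r\<bar> * C" if "u \<in> {0..v}" for u
    using that by (intro order_trans[OF abs_triangle_ineq4] add_mono) (auto simp: abs_mult mult_left_mono)
  then show "\<exists>B. \<forall>u\<in>{0..v}. \<bar>y u - r * z u\<bar> \<le> B" by blast
next
  fix u assume "0 < u \<and> u < a \<and> u \<noteq> c"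
  then show "isCont (\<lambda>x. y x - r * z x) u"
    using assms by (intro continuous_intros) (auto simp: solution_def)
next
  fix x assume x: "a \<le> x"
  have *: "integral {0..v} (\<lambda>x. y x - r * z x) = integral {0..v} y - r * integral {0..v} z" for v
    using solution_integrable[OF assms(1), of 0 v] solution_integrable[OF assms(2), of 0 v]
    by (subst Henstock_Kurzweil_Integration.integral_diff) (auto intro: integrable_on_mult_right)
  have "(x - a) * (y x - r * z x) = (x - a) * y x - r * ((x - a) * z x)"
    by (simp add: algebra_simps)
  also have "\<dots> = (K + integral {0..x - a} y + integral {0..x - c} y) -
      r * (L + integral {0..x - a} z + integral {0..x - c} z)"
    using assms x by (simp add: solution_def)
  finally show "(x - a) * (y x - r * z x) = K - r * L +
      integral {0..x - a} (\<lambda>x. y x - r * z x) + integral {0..x - c} (\<lambda>x. y x - r * z x)"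
    unfolding * by (simp add: algebra_simps)
qed

lemma pairing_diff:
  assumes "solution y K" "solution z L" "a \<le> x"
  shows "pairing (\<lambda>x. y x - r * z x) x = pairing y x - r * pairing z x"
proof -
  have *: "integral {u..v} (\<lambda>u. (y u - r * z u) * psi (u + k)) =
      integral {u..v} (\<lambda>u. y u * psi (u + k)) - r * integral {u..v} (\<lambda>u. z u * psi (u + k))"
    if "0 \<le> u" "a \<le> u + k" for u v k
  proof -
    have "integral {u..v} (\<lambda>u. y u * psi (u + k) - r * (z u * psi (u + k))) =
      integral {u..v} (\<lambda>u. y u * psi (u + k)) - r * integral {u..v} (\<lambda>u. z u * psi (u + k))"
      using product_integrable[OF assms(1) that, of v] product_integrable[OF assms(2) that, of v]
      by (subst Henstock_Kurzweil_Integration.integral_diff) (auto intro: integrable_on_mult_right)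
    then show ?thesis by (simp add: algebra_simps)
  qed
  show ?thesis
    unfolding pairing_def using assms(3) c_le c_pos by (subst (1 2) *) (auto simp: algebra_simps)
qed

text \<open>If \<open>y\<close> had no zero in \<open>[x - a, x]\<close>, it would keep a strict sign there by continuity, and so
  would its pairing at \<open>x\<close>, since \<open>psi\<close> is positive.\<close>

lemma pairing_zero_imp_root:
  assumes y: "solution y K" and 0: "pairing y a = 0" and x: "2 * a < x"
  obtains z where "z \<in> {x - a..x}" "y z = 0"
proof -
  have ax: "a < x" "a < x - a" using x a_pos by auto
  have cont: "continuous_on {x - a..x} y"
    using ax by (intro continuous_on_subset[OF solution_continuous[OF y]]) auto
  have pos: False if "solution w L" "pairing w a = 0" "\<And>u. u \<in> {x - a..x} \<Longrightarrow> 0 < w u" for w L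
  proof -
    have "0 < (x - a) * psi x * w x"
      using that(3)[of x] ax a_pos psi_bounds[of x] by simp
    moreover have "0 \<le> integral {x - a..x} (\<lambda>u. w u * psi (u + a))"
      using ax a_pos less_imp_le[OF that(3)] psi_nonneg
      by (intro integral_nonneg product_integrable[OF that(1)]) auto
    moreover have "0 \<le> integral {x - c..x} (\<lambda>u. w u * psi (u + c))"
      using ax c_pos c_le less_imp_le[OF that(3)] psi_nonneg
      by (intro integral_nonneg product_integrable[OF that(1)]) auto
    ultimately have "0 < pairing w x" by (simp add: pairing_def)
    then show False using pairing_const[OF that(1), of x] that(2) ax by simp
  qed
  have neg: "solution (\<lambda>x. 0 - 1 * y x) (0 - 1 * K)" "pairing (\<lambda>x. 0 - 1 * y x) a = 0"
  proof -
    have z: "solution (\<lambda>_. 0) 0" by (auto simp: solution_def)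
    show "solution (\<lambda>x. 0 - 1 * y x) (0 - 1 * K)" by (rule solution_diff[OF z y])
    show "pairing (\<lambda>x. 0 - 1 * y x) a = 0"
      using pairing_diff[OF z y, of a 1] 0 by (simp add: pairing_def)
  qed
  obtain u where u: "u \<in> {x - a..x}" "y u \<le> 0" using pos[OF y 0] by force
  obtain v where v: "v \<in> {x - a..x}" "0 \<le> y v" using pos[OF neg] by force
  have "connected (y ` {x - a..x})" by (intro connected_continuous_image cont) auto
  then have "0 \<in> y ` {x - a..x}" using u v connectedD_interval[of "y ` {x - a..x}" "y u" "y v" 0] by blast
  then show thesis using that by auto
qed

lemma integral_affine:
  fixes v k :: real
  assumes "0 \<le> v"
  shows "integral {0..v} (\<lambda>x. x + k) = v\<^sup>2 / 2 + k * v"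
  using has_integral_add[OF ident_has_integral[OF assms] has_integral_const_real[of k 0 v]] assms
  by (auto dest!: integral_unique)

lemma solution_affine: "solution (\<lambda>x. x + c) ((c\<^sup>2 - a\<^sup>2) / 2)"
  unfolding solution_def
proof (intro conjI allI impI)
  fix v
  have "\<forall>u\<in>{0..v}. \<bar>u + c\<bar> \<le> v + c" using c_pos by auto
  then show "\<exists>B. \<forall>u\<in>{0..v}. \<bar>u + c\<bar> \<le> B" by blast
next
  fix x assume "a \<le> x"
  then show "(x - a) * (x + c) =
      (c\<^sup>2 - a\<^sup>2) / 2 + integral {0..x - a} (\<lambda>x. x + c) + integral {0..x - c} (\<lambda>x. x + c)"
    using c_le by (simp add: integral_affine) (simp add: power2_eq_square field_simps)
qed auto

text \<open>The first term of the pairing tends to \<open>1\<close> because \<open>psi x\<close> is asymptotic to \<open>1 / x\<^sup>2\<close>; the two integrals are of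
  order \<open>1 / x\<close>.\<close>

lemma pairing_affine: "pairing (\<lambda>x. x + c) a = 1"
proof -
  let ?v = "\<lambda>x. (a + c) / (x - a)"
  have v: "(?v \<longlongrightarrow> 0) at_top"
    by (intro tendsto_divide_0[OF tendsto_const] filterlim_at_top_imp_at_infinity)
      (simp add: filterlim_at_top_add_at_top filterlim_tendsto_add_at_top[OF tendsto_const filterlim_ident, of "- a", simplified])
  have bounds: "1 / (1 + ?v x) \<le> pairing (\<lambda>x. x + c) x \<and>
      pairing (\<lambda>x. x + c) x \<le> (1 + ?v x) + ?v x * (1 + ?v x)" if x: "a < x" for x
  proof -
    define k where "k = x - a"
    have k: "0 < k" using x by (simp add: k_def)
    have xc: "x + c = k + (a + c)" by (simp add: k_def)
    have nn: "0 \<le> integral {x - j..x} (\<lambda>u. (u + c) * psi (u + j))"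
      "integral {x - j..x} (\<lambda>u. (u + c) * psi (u + j)) \<le> j * ((x + c) * (1 / k\<^sup>2))"
      if j: "0 \<le> j" "j \<le> a" "0 \<le> x - j" for j
    proof -
      have int: "(\<lambda>u. (u + c) * psi (u + j)) integrable_on {x - j..x}"
        using j x by (intro product_integrable[OF solution_affine]) auto
      show "0 \<le> integral {x - j..x} (\<lambda>u. (u + c) * psi (u + j))"
        using j c_pos psi_nonneg by (intro integral_nonneg int mult_nonneg_nonneg) auto
      have "integral {x - j..x} (\<lambda>u. (u + c) * psi (u + j)) \<le> integral {x - j..x} (\<lambda>u. (x + c) * (1 / k\<^sup>2))"
      proof (intro integral_le int integrable_const_ivl mult_mono)
        fix u assume u: "u \<in> {x - j..x}"
        have "psi (u + j) \<le> 1 / (u + j - a)\<^sup>2" using u x by (intro psi_bounds) auto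
        also have "\<dots> \<le> 1 / k\<^sup>2"
          using u k by (intro divide_left_mono power_mono mult_pos_pos zero_less_power) (auto simp: k_def)
        finally show "psi (u + j) \<le> 1 / k\<^sup>2" .
      qed (use x c_pos a_pos psi_nonneg in auto)
      also have "\<dots> = j * ((x + c) * (1 / k\<^sup>2))" using j by simp
      finally show "integral {x - j..x} (\<lambda>u. (u + c) * psi (u + j)) \<le> j * ((x + c) * (1 / k\<^sup>2))" .
    qed
    have T: "1 / (1 + ?v x) \<le> k * psi x * (x + c)" "k * psi x * (x + c) \<le> 1 + ?v x"
    proof -
      have "1 + ?v x = (x + c) / k"
        using k unfolding k_def[symmetric] xc by (simp add: field_simps)
      moreover have "0 < x + c" using x c_pos a_pos by linarith
      ultimately have "1 / (1 + ?v x) = k * (1 / (x + c)\<^sup>2) * (x + c)"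
        by (simp add: power2_eq_square)
      also have "\<dots> \<le> k * psi x * (x + c)"
        using psi_bounds(1)[OF x] k c_pos a_pos x by (intro mult_right_mono mult_left_mono) auto
      finally show "1 / (1 + ?v x) \<le> k * psi x * (x + c)" .
      have "k * psi x * (x + c) \<le> k * (1 / k\<^sup>2) * (x + c)"
        using psi_bounds(2)[OF x] k c_pos a_pos x by (intro mult_right_mono mult_left_mono) (auto simp: k_def)
      also have "\<dots> = 1 + ?v x"
        using k unfolding k_def[symmetric] xc by (simp add: power2_eq_square field_simps)
      finally show "k * psi x * (x + c) \<le> 1 + ?v x" .
    qed
    have "a * ((x + c) * (1 / k\<^sup>2)) + c * ((x + c) * (1 / k\<^sup>2)) = ?v x * (1 + ?v x)"
      using k unfolding k_def[symmetric] xc by (simp add: power2_eq_square field_simps)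
    moreover have "0 \<le> integral {x - a..x} (\<lambda>u. (u + c) * psi (u + a))"
      "integral {x - a..x} (\<lambda>u. (u + c) * psi (u + a)) \<le> a * ((x + c) * (1 / k\<^sup>2))"
      "0 \<le> integral {x - c..x} (\<lambda>u. (u + c) * psi (u + c))"
      "integral {x - c..x} (\<lambda>u. (u + c) * psi (u + c)) \<le> c * ((x + c) * (1 / k\<^sup>2))"
      by (rule nn; use x c_pos c_le in simp)+
    ultimately show ?thesis
      using T unfolding pairing_def k_def by linarith
  qed
  have ev: "\<forall>\<^sub>F x in at_top. a < x" by (rule eventually_gt_at_top)
  have "(pairing (\<lambda>x. x + c) \<longlongrightarrow> 1) at_top"
  proof (rule real_tendsto_sandwich)
    show "\<forall>\<^sub>F x in at_top. 1 / (1 + ?v x) \<le> pairing (\<lambda>x. x + c) x"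
      "\<forall>\<^sub>F x in at_top. pairing (\<lambda>x. x + c) x \<le> (1 + ?v x) + ?v x * (1 + ?v x)"
      using bounds by (auto intro: eventually_mono[OF ev])
    have "((\<lambda>x. 1 / (1 + ?v x)) \<longlongrightarrow> 1 / (1 + 0)) at_top"
      by (intro tendsto_divide tendsto_add tendsto_const v) simp
    then show "((\<lambda>x. 1 / (1 + ?v x)) \<longlongrightarrow> 1) at_top" by simp
    have "((\<lambda>x. (1 + ?v x) + ?v x * (1 + ?v x)) \<longlongrightarrow> (1 + 0) + 0 * (1 + 0)) at_top"
      by (intro tendsto_mult tendsto_add tendsto_const v)
    then show "((\<lambda>x. (1 + ?v x) + ?v x * (1 + ?v x)) \<longlongrightarrow> 1) at_top" by simp
  qed
  moreover have "(pairing (\<lambda>x. x + c) \<longlongrightarrow> pairing (\<lambda>x. x + c) a) at_top"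
    by (intro tendsto_eventually eventually_mono[OF eventually_ge_at_top[of a]]
        pairing_const[OF solution_affine])
  ultimately show ?thesis by (intro tendsto_unique[of at_top]) auto
qed

text \<open>At \<open>x = a\<close> the pairing only involves the initial segment. The condition \<open>a \<le> 2 c\<close> makes the second
  integral start, at \<open>a - c\<close>, within \<open>[0, c]\<close>; in the application it says that \<open>b \<ge> 0\<close>.\<close>

lemma pairing_initial:
  assumes y: "\<And>u. 0 \<le> u \<Longrightarrow> u < c \<Longrightarrow> y u = 1" "\<And>u. c \<le> u \<Longrightarrow> u < a \<Longrightarrow> y u = 3 / 2"
    and "a \<le> 2 * c"
  shows "pairing y a = G a + (G (2 * c) - G (2 * a)) / 2"
proof -
  have psi_int: "((\<lambda>u. psi (u + k)) has_integral (G (u + k) - G (v + k))) {u..v}"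
    if "a \<le> u + k" "u \<le> v" for u v k
    using has_integral_shift[of psi u k v] psi_has_integral[of "u + k" "v + k"] that
    by (auto simp: has_integral_iff)
  have piece1: "((\<lambda>u. y u * psi (u + k)) has_integral 1 * (G (u + k) - G (c + k))) {u..c}"
    if "a \<le> u + k" "0 \<le> u" "u \<le> c" for u k
    using that y(1)
    by (intro has_integral_spike_finite[OF _ _ has_integral_mult_right[OF psi_int], of "{c}"]) auto
  have piece2: "((\<lambda>u. y u * psi (u + k)) has_integral 3 / 2 * (G (c + k) - G (a + k))) {c..a}"
    if "a \<le> c + k" for k
    using that y(2) c_le
    by (intro has_integral_spike_finite[OF _ _ has_integral_mult_right[OF psi_int], of "{a}"]) auto
  \<comment> \<open>\<open>y\<close> equals \<open>1\<close> before \<open>c\<close> and \<open>3 / 2\<close> after it, and \<open>psi\<close> has the primitive \<open>- G\<close>.\<close>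
  have whole: "integral {u..a} (\<lambda>u. y u * psi (u + k)) =
      1 * (G (u + k) - G (c + k)) + 3 / 2 * (G (c + k) - G (a + k))"
    if "a \<le> u + k" "0 \<le> u" "u \<le> c" for u k
    using has_integral_combine[OF _ _ piece1[OF that] piece2] that c_le
    by (intro integral_unique) auto
  have ac: "G (a + c) = G a - G (2 * a)"
    using psi_eq[of a] by (simp flip: mult_2)
  have "integral {0..a} (\<lambda>u. y u * psi (u + a)) =
      G a - G (a + c) + 3 / 2 * (G (a + c) - G (2 * a))"
    using whole[of 0 a] c_pos by (simp add: add.commute[of c a] flip: mult_2)
  moreover have "integral {a - c..a} (\<lambda>u. y u * psi (u + c)) =
      G a - G (2 * c) + 3 / 2 * (G (2 * c) - G (a + c))"
    using whole[of "a - c" c] assms(3) c_le by (simp flip: mult_2)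
  ultimately have "pairing y a = G a - G (a + c) + 3 / 2 * (G (a + c) - G (2 * a)) +
      (G a - G (2 * c) + 3 / 2 * (G (2 * c) - G (a + c)))"
    by (simp add: pairing_def)
  then show ?thesis unfolding ac by argo
qed

section \<open>The integral formula for the constant\<close>

lemma exp_inner_integral:
  assumes "0 < t" "a + b = 2 * c"
  shows "exp (LINT s:{0<..<t}|lborel. (- 2 + exp (- s * (a + b) / 2) + exp (- a * s)) / s) = E t"
proof -
  have "(LINT s:{0<..<t}|lborel. (- 2 + exp (- s * (a + b) / 2) + exp (- a * s)) / s) =
      (LINT s:{0<..<t}|lborel. rate s)"
    by (intro set_lebesgue_integral_cong) (auto simp: rate_def assms(2) mult.commute)
  also have "\<dots> = integral {0<..<t} rate"
  proof (rule set_borel_integral_eq_integral(2))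
    have "set_integrable lborel {0..t} rate"
      using rate_continuous by (intro borel_integrable_atLeastAtMost') (rule continuous_on_subset, auto)
    then show "set_integrable lborel {0<..<t} rate"
      by (rule set_integrable_subset) auto
  qed
  also have "\<dots> = integral {0..t} rate"
    by (rule integral_open_interval_real[symmetric])
  finally show ?thesis by (simp add: E_def)
qed

lemma lambda_integrand_eq:
  assumes "0 < t" "a + b = 2 * c"
  shows "lambda_integrand a b t = (2 + exp (- (b * t)) - exp (- (a * t))) * E t"
  unfolding lambda_integrand_def exp_inner_integral[OF assms] by (simp add: mult.commute)

lemma lambda_integrand_integrable:
  assumes "0 \<le> b" "a + b = 2 * c"
  shows "set_integrable lborel {0<..} (lambda_integrand a b)"
proof -
  have "set_integrable lborel {0<..} (\<lambda>t. (2 + exp (- (b * t)) - exp (- (a * t))) * E t)"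
  proof (rule weighted_integrable[where B = 3])
    fix t :: real assume "0 < t"
    then have "exp (- (b * t)) \<le> 1" "exp (- (a * t)) \<le> 1"
      using assms a_pos by auto
    moreover have "0 < exp (- (b * t))" "0 < exp (- (a * t))" by auto
    ultimately show "\<bar>2 + exp (- (b * t)) - exp (- (a * t))\<bar> \<le> 3" by linarith
  qed (auto intro!: continuous_intros)
  then show ?thesis
    by (rule set_integrable_cong[THEN iffD1, rotated 3]) (auto simp: lambda_integrand_eq assms)
qed

text \<open>The exponents are \<open>0 = a - a\<close>, \<open>b = 2 c - a\<close> and \<open>a = 2 a - a\<close>.\<close>

lemma lam_eq:
  assumes "0 \<le> b" "a + b = 2 * c"
  shows "lam a b = G a + (G (2 * c) - G (2 * a)) / 2"
proof -
  have b: "2 * c - a = b" using assms by simp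
  have ring: "(2 + p - q) * e = 2 * (1 * e) + p * e - q * e" for p q e :: real
    by (simp add: algebra_simps)
  have "(LINT t:{0<..}|lborel. lambda_integrand a b t) =
      (LINT t:{0<..}|lborel. 2 * (exp (- ((a - a) * t)) * E t) + exp (- ((2 * c - a) * t)) * E t
        - exp (- ((2 * a - a) * t)) * E t)"
    by (intro set_lebesgue_integral_cong) (auto simp: lambda_integrand_eq assms b ring)
  also have "\<dots> = 2 * G a + G (2 * c) - G (2 * a)"
  proof -
    have "set_integrable lborel {0<..} (\<lambda>t. 2 * (exp (- ((a - a) * t)) * E t))"
      by (intro set_integrable_mult_right G_integrable) simp
    moreover have "set_integrable lborel {0<..} (\<lambda>t. exp (- ((2 * c - a) * t)) * E t)"
      "set_integrable lborel {0<..} (\<lambda>t. exp (- ((2 * a - a) * t)) * E t)"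
      by (rule G_integrable, use assms a_pos in linarith)+
    ultimately show ?thesis
      unfolding G_def by (simp only: set_integral_diff set_integral_add set_integral_mult_right)
  qed
  finally show ?thesis by (simp add: lam_def)
qed

text \<open>By \<open>psi_eq\<close> at \<open>a\<close>, \<open>\<lambda> = G (a + c) + G (2 a) / 2 + G (2 c) / 2\<close>, a sum of nonnegative terms of
  which the second is positive.\<close>

lemma lam_pos:
  assumes "0 \<le> b" "a + b = 2 * c"
  shows "0 < lam a b"
proof -
  have nonneg: "0 \<le> G x" for x
    unfolding G_def set_lebesgue_integral_def
    by (intro Bochner_Integration.integral_nonneg) (auto simp: indicator_def less_imp_le[OF E_pos])
  have "0 < (3 * a - 2 * a) * psi (3 * a)" using psi_bounds(3)[of "3 * a"] a_pos by simp
  also have "\<dots> \<le> G (2 * a) - G (3 * a)" using a_pos by (intro G_diff) auto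
  finally have "0 < G (2 * a)" using nonneg[of "3 * a"] by linarith
  moreover have "G a = G (a + c) + G (2 * a)"
    using psi_eq[of a] by (simp flip: mult_2)
  moreover from this have "lam a b = G (a + c) + G (2 * a) / 2 + G (2 * c) / 2"
    by (simp add: lam_eq[OF assms] field_simps)
  ultimately show ?thesis
    using nonneg[of "a + c"] nonneg[of "2 * c"] by linarith
qed

end

section \<open>Factorial decay of solutions with vanishing pairing\<close>

text \<open>The decay bound as a function of \<open>z = x / a\<close>, up to a constant factor. It is at least \<open>2\<close> on
  \<open>[2, 3]\<close>, where the iteration starts.\<close>

definition decay :: "real \<Rightarrow> real" where
  "decay z = (2 * exp 1 / z) powr (z - 3 / 2) * (exp (3 / 2) / sqrt pi)"

lemma decay_ge_2:
  assumes "2 \<le> z" "z \<le> 3"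
  shows "2 \<le> decay z"
proof -
  have e: "2 \<le> exp (1::real)" using exp_ge_add_one_self[of 1] by simp
  then have "1 \<le> 2 * exp 1 / z" using assms by (simp add: field_simps)
  then have 1: "1 \<le> (2 * exp 1 / z) powr (z - 3 / 2)"
    using assms by (intro ge_one_powr_ge_zero) auto
  have "(8 / 5 :: real) \<le> exp (1 / 2)"
    using exp_lower_Taylor_quadratic[of "1 / 2"] by (simp add: power2_eq_square)
  then have "(8 / 5 :: real) ^ 3 \<le> exp (1 / 2) ^ 3" by (intro power_mono) auto
  also have "exp (1 / 2 :: real) ^ 3 = exp (3 / 2)" by (simp flip: exp_of_nat_mult)
  finally have "4 \<le> exp (3 / 2 :: real)" by (simp add: power3_eq_cube)
  moreover have "sqrt pi \<le> 2" using pi_less_4 real_le_lsqrt[of 2 pi] by (simp add: real_le_lsqrt)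
  ultimately have "2 * sqrt pi \<le> exp (3 / 2)" by linarith
  then have "2 \<le> exp (3 / 2) / sqrt pi" by (simp add: field_simps)
  from mult_mono[OF 1 this] show ?thesis by (simp add: decay_def)
qed

text \<open>On taking logarithms, this is \<open>(z - 1/2) ln (1 + 1/z) \<le> 1\<close>.\<close>

lemma decay_step:
  assumes "1 \<le> z"
  shows "2 / z * decay z \<le> decay (z + 1)"
proof -
  have z: "0 < z" using assms by simp
  define l where "l = ln z"
  define L where "L = ln (z + 1)"
  have "L - l = ln ((z + 1) / z)" using z by (simp add: L_def l_def ln_div)
  also have "(z + 1) / z = 1 + 1 / z" using z by (simp add: field_simps)
  also have "ln (1 + 1 / z) \<le> 1 / z" using z by (intro ln_add_one_self_le_self) auto
  finally have "(z - 1 / 2) * (L - l) \<le> (z - 1 / 2) * (1 / z)"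
    using assms by (intro mult_left_mono) auto
  also have "\<dots> \<le> 1" using z by (simp add: field_simps)
  finally have *: "(z - 1 / 2) * (L - l) \<le> 1" .
  have e: "2 / z = exp (ln 2 - l)"
    using z by (simp add: exp_diff l_def)
  have p: "(2 * exp 1 / w) powr q = exp (q * (ln 2 + 1 - ln w))" if "0 < w" for w q :: real
    using that by (simp add: powr_def ln_div ln_mult)
  have "2 / z * (2 * exp 1 / z) powr (z - 3 / 2) = exp (ln 2 - l + (z - 3 / 2) * (ln 2 + 1 - l))"
    unfolding e p[OF z] l_def[symmetric] by (simp add: exp_add)
  also have "ln 2 - l + (z - 3 / 2) * (ln 2 + 1 - l) =
      (z + 1 - 3 / 2) * (ln 2 + 1 - L) + ((z - 1 / 2) * (L - l) - 1)"
    by (simp add: field_simps)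
  also have "exp \<dots> \<le> exp ((z + 1 - 3 / 2) * (ln 2 + 1 - L))"
    using * by simp
  also have "\<dots> = (2 * exp 1 / (z + 1)) powr (z + 1 - 3 / 2)"
    using z by (simp add: p L_def)
  finally have "2 / z * (2 * exp 1 / z) powr (z - 3 / 2) * (exp (3 / 2) / sqrt pi) \<le>
      (2 * exp 1 / (z + 1)) powr (z + 1 - 3 / 2) * (exp (3 / 2) / sqrt pi)"
    by (intro mult_right_mono) auto
  then show ?thesis by (simp only: decay_def mult.assoc)
qed

context delays
begin

lemma integral_difference_bound:
  assumes "solution f K" "0 \<le> u" "0 \<le> v" "\<And>w. min u v \<le> w \<Longrightarrow> w \<le> max u v \<Longrightarrow> \<bar>f w\<bar> \<le> B"
  shows "\<bar>integral {0..v} f - integral {0..u} f\<bar> \<le> B * \<bar>v - u\<bar>"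
proof -
  have *: "\<bar>integral {0..v} f - integral {0..u} f\<bar> \<le> B * (v - u)"
    if "0 \<le> u" "u \<le> v" "\<And>w. u \<le> w \<Longrightarrow> w \<le> v \<Longrightarrow> \<bar>f w\<bar> \<le> B" for u v
  proof -
    have "integral {0..v} f - integral {0..u} f = integral {u..v} f"
      using Henstock_Kurzweil_Integration.integral_combine[of 0 u v f]
        solution_integrable[OF assms(1), of 0 v] that by simp
    moreover have "0 \<le> B" using that(3)[of u] that(2) by linarith
    then have "norm (integral {u..v} f) \<le> B * (v - u)"
      using that solution_integrable[OF assms(1), of u v]
        has_integral_bound_real[of B "{}" f "integral {u..v} f" u v]
      by (simp add: has_integral_integral)
    ultimately show ?thesis by simp
  qed
  show ?thesis
  proof (cases "u \<le> v")
    case True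
    then show ?thesis using *[of u v] assms by simp
  next
    case False
    then show ?thesis using *[of v u] assms by (simp add: abs_minus_commute)
  qed
qed

text \<open>The difference of the equations at \<open>x\<close> and at a zero \<open>z\<close> bounds \<open>(x - a) f(x)\<close> by the integrals of \<open>f\<close> over
  two intervals of length \<open>\<bar>x - z\<bar>\<close>.\<close>

lemma bound_from_root:
  assumes f: "solution f K" and "a < x" "a \<le> z" "f z = 0" "\<bar>x - z\<bar> \<le> a"
    and B: "\<And>w. min x z - a \<le> w \<Longrightarrow> w \<le> max x z - c \<Longrightarrow> \<bar>f w\<bar> \<le> B"
  shows "\<bar>f x\<bar> \<le> 2 * a * B / (x - a)"
proof -
  have "min x z - a \<le> max x z - c" using c_le by linarith
  then have B0: "0 \<le> B" using B[of "min x z - a"] by linarith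
  have "\<bar>integral {0..x - k} f - integral {0..z - k} f\<bar> \<le> B * \<bar>(x - k) - (z - k)\<bar>"
    if "k = a \<or> k = c" for k
    using that assms c_le c_pos by (intro integral_difference_bound[OF f] B) auto
  moreover have "B * \<bar>x - z\<bar> \<le> B * a" using B0 assms by (intro mult_left_mono) auto
  ultimately have "\<bar>integral {0..x - k} f - integral {0..z - k} f\<bar> \<le> B * a"
    if "k = a \<or> k = c" for k
    using that by fastforce
  from this[of a] this[of c]
  have "\<bar>integral {0..x - a} f - integral {0..z - a} f\<bar> \<le> B * a"
    "\<bar>integral {0..x - c} f - integral {0..z - c} f\<bar> \<le> B * a"
    by simp_all
  moreover have "(x - a) * f x = K + integral {0..x - a} f + integral {0..x - c} f"
    "(z - a) * f z = K + integral {0..z - a} f + integral {0..z - c} f"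
    using f assms(2,3) unfolding solution_def by (meson less_imp_le)+
  ultimately have "\<bar>(x - a) * f x\<bar> \<le> 2 * (B * a)"
    using \<open>f z = 0\<close> by (simp only: mult_zero_right)
  then have "\<bar>f x\<bar> * (x - a) \<le> 2 * a * B"
    using \<open>a < x\<close> by (simp add: abs_mult mult_ac)
  then show ?thesis
    using \<open>a < x\<close> by (subst pos_le_divide_eq) auto
qed

text \<open>A zero to the left of \<open>x\<close> bounds \<open>f(x)\<close> by values at points up to \<open>x - c\<close>, so the bound propagates in steps of
  length \<open>c\<close>.\<close>

lemma solution_bounded_everywhere:
  assumes f: "solution f K" "pairing f a = 0"
    and B: "\<And>x. 2 * a \<le> x \<Longrightarrow> x \<le> 4 * a \<Longrightarrow> \<bar>f x\<bar> \<le> B"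
    and "2 * a \<le> x"
  shows "\<bar>f x\<bar> \<le> B"
proof -
  have B0: "0 \<le> B" using B[of "2 * a"] a_pos by linarith
  have "\<bar>f x\<bar> \<le> B" if "2 * a \<le> x" "x \<le> 4 * a + real n * c" for n x
    using that
  proof (induction n arbitrary: x)
    case (Suc n)
    show ?case
    proof (cases "x \<le> 4 * a")
      case False
      then obtain z where z: "z \<in> {x - a..x}" "f z = 0"
        using pairing_zero_imp_root[OF f, of x] a_pos by auto
      have "x \<le> 4 * a + real n * c + c" using Suc.prems by (simp add: algebra_simps)
      then have "\<bar>f x\<bar> \<le> 2 * a * B / (x - a)"
        using z False a_pos by (intro bound_from_root[OF f(1), of x z] Suc.IH) auto
      also have "\<dots> \<le> 2 * a * B / (2 * a)"
        using False a_pos B0 by (intro divide_left_mono mult_nonneg_nonneg mult_pos_pos) auto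
      finally show ?thesis using a_pos by simp
    qed (use B Suc.prems in auto)
  qed (use B in auto)
  moreover obtain n where "(x - 4 * a) / c \<le> real n" using real_arch_simple by blast
  then have "x \<le> 4 * a + real n * c" using c_pos by (simp add: field_simps)
  ultimately show ?thesis using assms by blast
qed

text \<open>A zero to the right of \<open>x\<close>, in \<open>[x, x + a]\<close>, is used here, so that only values of \<open>f\<close> on \<open>[x - a, \<infinity>)\<close> enter. A
  zero to the left would give the same gain only per step of length \<open>2 a\<close>.\<close>

lemma solution_bound_gain:
  assumes f: "solution f K" "pairing f a = 0"
    and u: "2 * a \<le> u" and B: "\<And>x. u - a \<le> x \<Longrightarrow> \<bar>f x\<bar> \<le> B" and x: "u \<le> x"
  shows "\<bar>f x\<bar> \<le> 2 * a / (u - a) * B"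
proof -
  have B0: "0 \<le> B" using B[of u] a_pos by linarith
  obtain z where z: "z \<in> {x + a - a..x + a}" "f z = 0"
    using pairing_zero_imp_root[OF f, of "x + a"] u x a_pos by auto
  then have "\<bar>f x\<bar> \<le> 2 * a * B / (x - a)"
    using u x a_pos by (intro bound_from_root[OF f(1), of x z] B) auto
  also have "\<dots> \<le> 2 * a * B / (u - a)"
    using u x a_pos B0 by (intro divide_left_mono mult_nonneg_nonneg mult_pos_pos) auto
  finally show ?thesis by simp
qed

lemma solution_decay:
  assumes f: "solution f K" "pairing f a = 0"
    and B: "\<And>x. 2 * a \<le> x \<Longrightarrow> x \<le> 4 * a \<Longrightarrow> \<bar>f x\<bar> \<le> 2 * M" and x: "2 * a \<le> x"
  shows "\<bar>f x\<bar> \<le> M * decay (x / a)"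
proof -
  have M: "0 \<le> M" using B[of "2 * a"] a_pos by linarith
  have ind: "\<bar>f x\<bar> \<le> M * decay (v + real m)" if "2 \<le> v" "v \<le> 3" "(v + real m) * a \<le> x" for v m x
    using that(3)
  proof (induction m arbitrary: x)
    case 0
    have "2 * a \<le> v * a" using that a_pos by simp
    then have "\<bar>f x\<bar> \<le> M * 2"
      using solution_bounded_everywhere[OF f B, of x] 0 by simp
    also have "\<dots> \<le> M * decay (v + real 0)" using decay_ge_2[of v] that M by (intro mult_left_mono) auto
    finally show ?case .
  next
    case (Suc m)
    define z where "z = v + real m"
    have z: "2 \<le> z" using that by (simp add: z_def)
    then have za: "2 * a \<le> z * a" using a_pos by simp
    have "\<bar>f x\<bar> \<le> 2 * a / ((z + 1) * a - a) * (M * decay z)"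
    proof (rule solution_bound_gain[OF f])
      show "2 * a \<le> (z + 1) * a" using za a_pos by (simp add: algebra_simps)
      show "(z + 1) * a \<le> x" using Suc.prems by (simp add: z_def algebra_simps)
      show "\<bar>f w\<bar> \<le> M * decay z" if "(z + 1) * a - a \<le> w" for w
        using Suc.IH[of w] that by (simp add: z_def algebra_simps)
    qed
    also have "2 * a / ((z + 1) * a - a) * (M * decay z) = M * (2 / z * decay z)"
      using z a_pos by (simp add: field_simps)
    also have "\<dots> \<le> M * decay (z + 1)" using z M by (intro mult_left_mono decay_step) auto
    finally show ?case by (simp add: z_def algebra_simps)
  qed
  define m where "m = nat (\<lfloor>x / a\<rfloor> - 2)"
  have "2 \<le> x / a" using x a_pos by (simp add: field_simps)
  then have m: "real m = of_int \<lfloor>x / a\<rfloor> - 2" by (simp add: m_def)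
  have "2 \<le> x / a - real m" "x / a - real m \<le> 3" unfolding m by linarith+
  moreover have "(x / a - real m + real m) * a \<le> x" using a_pos by simp
  ultimately show ?thesis using ind[of "x / a - real m" m x] by simp
qed

end

section \<open>The asymptotics of the mean count\<close>

theorem theorem1p5:
  fixes a b :: real
  assumes "0 \<le> b" and "b \<le> a" and "0 < a"
  shows "set_integrable lborel {0<..} (lambda_integrand a b) \<and> 0 < lam a b \<and>
    ((\<lambda>x. eta a b x / x) \<longlongrightarrow> lam a b) at_top \<and>
    0 < K1 a b \<and> 0 \<le> K2 a b \<and>
    (\<forall>x > 2 * a * (exp 1 + 1).
       \<bar>eta a b x - lam a b * x + 1 - lam a b * ((a + b) / 2)\<bar> \<le>
         (if a = b
          then (2 * exp 1 / (x / a)) powr (x / a - 3 / 2) * (exp (3 / 2) * K1 a b / sqrt pi)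
          else (2 * exp 1 / (x / a)) powr (x / a - 5 / 2) *
                 (3 * exp (5 / 2) * (2 * K1 a b + K2 a b) / sqrt pi)))"
proof -
  have valid: "valid_params a b" using assms by (simp add: valid_params_def)
  define c where "c = (a + b) / 2"
  interpret delays a c
    by unfold_locales (use assms in \<open>auto simp: c_def\<close>)
  have c2: "a + b = 2 * c" "a \<le> 2 * c" using assms by (simp_all add: c_def)
  note \<eta>_bounds = eta_bounds[OF valid, folded c_def]
  define \<Lambda> where "\<Lambda> = lam a b"
  have \<Lambda>: "0 < \<Lambda>" using lam_pos[OF assms(1) c2(1)] by (simp add: \<Lambda>_def)
  define y where "y x = eta a b x + 1" for x
  have y1: "y u = 1" if "u < c" for u
    using eta_zero[OF valid, of u] that by (simp add: y_def c_def)
  have y2: "y u = 3 / 2" if "c \<le> u" "u < a" for u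
    using eta_half[OF valid, of u] that by (simp add: y_def c_def)
  have y_int: "integral {0..v} y = integral {0..v} (eta a b) + v" if "0 \<le> v" for v
    unfolding y_def[abs_def] using that eta_integrable[OF valid, of 0 v]
    by (subst Henstock_Kurzweil_Integration.integral_add) auto
  have sol: "solution y (c - a)"
    unfolding solution_def
  proof (intro conjI allI impI)
    show "y \<in> borel_measurable borel"
      using eta_measurable[OF valid] by (simp add: y_def[abs_def])
    fix v :: real
    have "\<bar>y u\<bar> \<le> v / c + 1" if "u \<in> {0..v}" for u
    proof -
      have "u / c \<le> v / c" using that c_pos by (intro divide_right_mono) auto
      then show ?thesis using \<eta>_bounds[of u] that by (simp add: y_def)
    qed
    then show "\<exists>B. \<forall>u\<in>{0..v}. \<bar>y u\<bar> \<le> B" by blast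
  next
    fix u assume u: "0 < u \<and> u < a \<and> u \<noteq> c"
    have "\<forall>\<^sub>F v in nhds u. y v = (if u < c then 1 else 3 / 2)"
    proof (cases "u < c")
      case True
      then show ?thesis
        using eventually_nhds_in_open[of "{..<c}" u] y1 by (auto elim: eventually_mono)
    next
      case False
      then show ?thesis
        using eventually_nhds_in_open[of "{c<..<a}" u] y2 u by (auto elim!: eventually_mono)
    qed
    then show "isCont y u" by (subst isCont_cong) auto
  next
    fix x assume x: "a \<le> x"
    then show "(x - a) * y x = c - a + integral {0..x - a} y + integral {0..x - c} y"
      using eta_equation[OF valid x] c_le by (simp add: y_int c_def[symmetric]) (simp add: y_def algebra_simps)
  qed
  define f where "f x = y x - \<Lambda> * (x + c)" for x
  obtain K where f: "solution f K"
    using solution_diff[OF sol solution_affine, of \<Lambda>] by (auto simp: f_def[abs_def])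
  have f0: "pairing f a = 0"
    using pairing_diff[OF sol solution_affine, of a \<Lambda>] pairing_affine
      pairing_initial[OF y1 y2 c2(2)] lam_eq[OF assms(1) c2(1)]
    by (simp add: f_def[abs_def] \<Lambda>_def)
  define M where "M = K1 a b"
  have M: "M = 1 + 2 * a * (1 / c + \<Lambda>) + \<Lambda> * c"
    by (simp add: M_def K1_def c_def \<Lambda>_def)
  have "0 < 2 * a * (1 / c + \<Lambda>)" "0 < \<Lambda> * c"
    using a_pos c_pos \<Lambda> by (auto intro!: mult_pos_pos add_pos_pos)
  then have M_pos: "0 < M" unfolding M by linarith
  \<comment> \<open>The trivial bound \<open>0 \<le> \<eta>(x) \<le> x / c\<close> suffices on the starting interval.\<close>
  have f_initial: "\<bar>f x\<bar> \<le> 2 * M" if "2 * a \<le> x" "x \<le> 4 * a" for x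
  proof -
    have "x / c \<le> 4 * a / c" using that c_pos by (intro divide_right_mono) auto
    moreover have "\<Lambda> * x \<le> \<Lambda> * (4 * a)" using that \<Lambda> by (intro mult_left_mono) auto
    moreover have "0 \<le> \<Lambda> * x" "0 \<le> \<Lambda> * c" "0 \<le> a / c" "0 \<le> \<Lambda> * a" using that \<Lambda> a_pos c_pos by auto
    moreover have "0 \<le> eta a b x" "eta a b x \<le> x / c" using \<eta>_bounds[of x] that a_pos by auto
    moreover have "f x = eta a b x + 1 - \<Lambda> * x - \<Lambda> * c" by (simp add: f_def y_def algebra_simps)
    moreover have "2 * M = 2 + 4 * a / c + 4 * (\<Lambda> * a) + 2 * (\<Lambda> * c)" by (simp add: M algebra_simps)
    ultimately show ?thesis by linarith
  qed
  have f_decay: "\<bar>f x\<bar> \<le> M * decay (x / a)" if "2 * a \<le> x" for x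
    using solution_decay[OF f f0 f_initial that] .
  have f_bounded: "\<bar>f x\<bar> \<le> 2 * M" if "2 * a \<le> x" for x
    using solution_bounded_everywhere[OF f f0 f_initial that] .
  have "((\<lambda>x. eta a b x / x) \<longlongrightarrow> \<Lambda>) at_top"
  proof -
    define D where "D = 2 * M + 1 + \<Lambda> * c"
    have "((\<lambda>x. eta a b x / x - \<Lambda>) \<longlongrightarrow> 0) at_top"
    proof (rule Lim_null_comparison)
      show "((\<lambda>x. D / x) \<longlongrightarrow> 0) at_top"
        by (intro tendsto_divide_0[OF tendsto_const] filterlim_at_top_imp_at_infinity filterlim_ident)
      have "norm (eta a b x / x - \<Lambda>) \<le> D / x" if "2 * a \<le> x" for x
      proof -
        have x: "0 < x" using that a_pos by linarith
        have "\<bar>eta a b x - \<Lambda> * x\<bar> \<le> D"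
          using f_bounded[OF that] mult_pos_pos[OF \<Lambda> c_pos]
          unfolding f_def y_def D_def distrib_left by linarith
        then have "\<bar>eta a b x - \<Lambda> * x\<bar> / x \<le> D / x" using x by (intro divide_right_mono) auto
        also have "\<bar>eta a b x - \<Lambda> * x\<bar> / x = \<bar>(eta a b x - \<Lambda> * x) / x\<bar>" using x by simp
        also have "(eta a b x - \<Lambda> * x) / x = eta a b x / x - \<Lambda>" using x by (simp add: diff_divide_distrib)
        finally show ?thesis by simp
      qed
      then show "\<forall>\<^sub>F x in at_top. norm (eta a b x / x - \<Lambda>) \<le> D / x"
        by (rule eventually_mono[OF eventually_ge_at_top[of "2 * a"]])
    qed
    then show ?thesis by (simp add: LIM_zero_iff)
  qed
  moreover have K2: "0 \<le> K2 a b"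
    using assms \<Lambda> by (simp add: K2_def \<Lambda>_def)
  moreover have "\<bar>eta a b x - lam a b * x + 1 - lam a b * ((a + b) / 2)\<bar> \<le>
      (if a = b
       then (2 * exp 1 / (x / a)) powr (x / a - 3 / 2) * (exp (3 / 2) * K1 a b / sqrt pi)
       else (2 * exp 1 / (x / a)) powr (x / a - 5 / 2) *
              (3 * exp (5 / 2) * (2 * K1 a b + K2 a b) / sqrt pi))"
    if x: "2 * a * (exp 1 + 1) < x" for x
  proof -
    define z where "z = x / a"
    have z: "2 * (exp 1 + 1) < z" using x a_pos by (simp add: z_def field_simps)
    have "0 < 2 * (exp 1 + 1 :: real)" by (simp add: add_pos_pos)
    then have z0: "0 < z" using z by (rule order.strict_trans)
    have "2 * a * 1 \<le> 2 * a * (exp 1 + 1)" using a_pos by (intro mult_left_mono) auto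
    then have "2 * a \<le> x" using x by linarith
    then have "\<bar>f x\<bar> \<le> M * decay z" unfolding z_def by (rule f_decay)
    also have "f x = eta a b x - lam a b * x + 1 - lam a b * ((a + b) / 2)"
      by (simp add: f_def y_def \<Lambda>_def c_def algebra_simps)
    finally have *: "\<bar>eta a b x - lam a b * x + 1 - lam a b * ((a + b) / 2)\<bar> \<le> M * decay z" .
    show ?thesis
    proof (cases "a = b")
      case True
      then show ?thesis using * by (simp add: decay_def M_def z_def mult_ac)
    next
      case False
      define p where "p = (2 * exp 1 / z) powr (z - 5 / 2)"
      \<comment> \<open>As \<open>2 e / z \<le> 1\<close>, the bound for \<open>a > b\<close> is weaker than the one for \<open>a = b\<close>.\<close>
      have "(2 * exp 1 / z) powr (z - 3 / 2) = (2 * exp 1 / z) powr ((z - 5 / 2) + 1)" by simp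
      also have "\<dots> = p * (2 * exp 1 / z)" using z0 by (subst powr_add) (simp add: p_def)
      also have "\<dots> \<le> p * 1" using z z0 by (intro mult_left_mono) (auto simp: p_def)
      finally have 1: "(2 * exp 1 / z) powr (z - 3 / 2) \<le> p" by simp
      have "exp (3 / 2) * M \<le> exp (5 / 2) * (3 * (2 * M + K2 a b))"
        using M_pos K2 by (intro mult_mono) auto
      also have "\<dots> = 3 * exp (5 / 2) * (2 * M + K2 a b)" by simp
      finally have 2: "exp (3 / 2) * M / sqrt pi \<le> 3 * exp (5 / 2) * (2 * M + K2 a b) / sqrt pi"
        by (intro divide_right_mono) auto
      have "M * decay z = (2 * exp 1 / z) powr (z - 3 / 2) * (exp (3 / 2) * M / sqrt pi)"
        by (simp add: decay_def)
      also have "\<dots> \<le> p * (3 * exp (5 / 2) * (2 * M + K2 a b) / sqrt pi)"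
        using M_pos by (intro mult_mono 1 2) (auto simp: p_def)
      finally show ?thesis using * False by (simp add: p_def z_def M_def)
    qed
  qed
  ultimately show ?thesis
    using lambda_integrand_integrable[OF assms(1) c2(1)] \<Lambda> M_pos
    by (simp add: \<Lambda>_def M_def)
qed

end
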